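(* Let $I=(A,B,\succ,q)$ be a school matching instance, let $\mathcal F\subseteq\mathcal S(I)$ be non-empty, and let $f:\mathcal F\to\mathbb R$. The optimization problem $\Pi(f,\mathcal F):\ \min_{M\in\mathcal F} f(M)$ is minimum cut representable if and only if the following three conditions hold: (i) $\mathcal F$ is a sublattice of $(\mathcal S(I),\ge)$; (ii) for every pair of distinct proper meta-rotations $\theta\ne\theta'\in\mathcal R^{\mathcal F}_{\sf prop}(I)$, $\ \partial^2 f_{\theta,\theta'}\ge 0$; (iii) for every $M\in\mathcal F$, $$f(M)=f(M_0^{\mathcal F})+\sum_{\theta\in\Theta_M}\partial f_\theta-\frac12\sum_{\theta\ne\theta'\in\Theta_M}\partial^2 f_{\theta,\theta'},$$ where the last sum is over ordered pairs $(\theta,\theta')$ of distinct elements of $\Theta_M$. Moreover, when $\Pi(f,\mathcal F)$ is minimum cut representable, the cut digraph $\mathcal D^{f,\mathcal F}$ associated to $(f,\mathcal F)$ is a witness digraph.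
   Context: **School matching instances.** A school matching instance $I=(A,B,\succ,q)$ consists of a finite set $A$ of students, a finite set $B$ of schools, for each $a\in A$ a strict total order $\succ_a$ on $B^+=B\cup\{\emptyset\}$, for each $b\in B$ a strict total order $\succ_b$ on $A^+=A\cup\{\emptyset\}$ ($\emptyset$ is the outside option), and for each $b\in B$ a quota $q_b\in\mathbb N$, $q_b\le|A|$. A matching is a set of pairs $M\subset (A^+\times B^+)\setminus\{(\emptyset,\emptyset)\}$ in which every $a\in A$ is paired with exactly one element $M(a)\in B^+$, and every $b\in B$ is paired either with exactly $q_b$ students or with at most $q_b-1$ students and the outside option; $M(b)\subset A^+$ is the set of partners of $b$. $M$ is stable if there is no $ab\in A\times B$ with $b\succ_a M(a)$ and $a\succ_b a'$ for some $a'\in M(b)$, no $a\in A$ with $\emptyset\succ_a M(a)$, and no $b\in B$ with $\emptyset\succ_b a'$ for some $a'\in M(b)$. $\mathcal S(I)$ is the set of stable matchings, ordered by $M\ge M'$ iff $M(a)\succeq_a M'(a)$ for all $a\in A$. It is known that $(\mathcal S(I),\ge)$ is a lattice; $\vee,\wedge$ denote join and meet (each student gets the more, resp. less, preferred of their two partners). $M_0$ and $M_z$ denote the largest (student-optimal) and smallest (student-pessimal) elements. A subset $\mathcal F\subseteq\mathcal S(I)$ is a sublattice if it is closed under $\vee$ and $\wedge$. **Rotations.** $M'$ is an immediate predecessor of $M$ if $M'<M$ and no stable $M''$ satisfies $M'<M''<M$. Then $\rho(M,M')=(M\setminus M',M'\setminus M)$ is called a rotation, exposed in $M$; its elimination from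 $M$ yields $M'$. $\mathcal R(I)$ is the set of all rotations. For each $M\in\mathcal S(I)$ there is a chain $M_0,M_1,\dots,M_k=M$ with each $M_i$ an immediate predecessor of $M_{i-1}$; the set $R_M=\{\rho(M_{i-1},M_i):i\in[k]\}$ does not depend on the chain. Order: $\rho\trianglerighteq\rho'$ iff $\rho=\rho'$ or $\rho\in R_M$ for every $M\in\mathcal S(I)$ in which $\rho'$ is exposed. A subset of a poset is upper-closed if it contains every element that is $\ge$ one of its elements. It is known that $M\mapsto R_M$ is a bijection from $\mathcal S(I)$ to upper-closed subsets of $(\mathcal R(I),\trianglerighteq)$, with $R_{M\wedge M'}=R_M\cup R_{M'}$, $R_{M\vee M'}=R_M\cap R_{M'}$; the inverse is denoted $R\mapsto M_R$. **Minimum cut representability.** $\Pi(f,\mathcal F)$ is minimum cut representable if there are a digraph $\mathcal D$ with vertex set $\mathcal R(I)\cup\{s,t\}$ and non-negative, possibly infinite, arc capacities, and a real $C$, such that (1) for every $R\subseteq\mathcal R(I)$, the $s$-$t$ cut $\{s\}\cup R$ (its capacity is the total capacity of arcs leaving $\{s\}\cup R$) has finite capacity iff $R$ is upper-closed in $(\mathcal R(I),\trianglerighteq)$ and $M_R\in\mathcal F$; (2) each finite capacity cut $\{s\}\cup R$ has capacity $f(M_R)+C$. Such a $\mathcal D$ is called a witness digraph. **Meta-rotations and differentials.** Let $\mathcal F$ be a non-empty sublattice of $\mathcal S(I)$. $M_0^{\mathcal F}$ is the join of all elements of $\mathcal F$. Define $\rho\sim\rho'$ on $\mathcal R(I)$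 iff for every $M\in\mathcal F$ either $\rho,\rho'\in R_M$ or $\rho,\rho'\notin R_M$. Let $\theta_0^{\mathcal F}=\{\rho:\rho\in R_M\ \forall M\in\mathcal F\}$ and $\theta_z^{\mathcal F}=\{\rho:\rho\notin R_M\ \forall M\in\mathcal F\}$ (trivial meta-rotations, possibly empty); the remaining equivalence classes of $\sim$ are the proper meta-rotations, forming the set $\mathcal R^{\mathcal F}_{\sf prop}(I)$; $\mathcal R^{\mathcal F}(I)$ is the set of all meta-rotations. Order proper meta-rotations by $\theta\trianglerighteq^{\mathcal F}\theta'$ iff for each $M\in\mathcal F$, $\theta'\subseteq R_M$ implies $\theta\subseteq R_M$. For $M\in\mathcal F$, $\Theta_M=\{\theta\in\mathcal R^{\mathcal F}_{\sf prop}(I):\theta\subseteq R_M\}$; it is known that $M\mapsto\Theta_M$ is a bijection from $\mathcal F$ onto the upper-closed subsets of $(\mathcal R^{\mathcal F}_{\sf prop}(I),\trianglerighteq^{\mathcal F})$, with inverse $\Theta\mapsto M_\Theta$. For proper $\theta$ let $M^\theta=M_{\{\theta':\theta'\trianglerighteq^{\mathcal F}\theta\}}$ and $M_\theta=M_{\{\theta':\theta'\triangleright^{\mathcal F}\theta\}}$. The differentials of $f$ are $$\partial f_\theta=f(M^\theta)-f(M_\theta),$$ $$\partial^2f_{\theta,\theta'}=f(M^\theta\wedge M_{\theta'})+f(M_\theta\wedge M^{\theta'})-f(M_\theta\wedge M_{\theta'})-f(M^\theta\wedge M^{\theta'})\quad(\theta\ne\theta').$$ **Cut digraph $\mathcal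 D^{f,\mathcal F}$.** For each (non-empty) meta-rotation $\theta$ choose an arbitrary representative rotation $\widehat\theta\in\theta$. The vertex set is $\mathcal R(I)\cup\{s,t\}$ and the arcs are: for each meta-rotation $\theta$, arcs of infinite capacity (in both directions) between every two rotations of $\theta$; for proper $\theta\triangleleft^{\mathcal F}\theta'$, an arc $\widehat\theta\to\widehat{\theta'}$ of infinite capacity; for every ordered pair of distinct proper $\theta,\theta'$, an arc $\widehat\theta\to\widehat{\theta'}$ of capacity $\frac12\partial^2f_{\theta,\theta'}$; arcs $s\to\widehat{\theta_0^{\mathcal F}}$ and $\widehat{\theta_z^{\mathcal F}}\to t$ of infinite capacity (whenever these trivial meta-rotations are non-empty); for each proper $\theta$, an arc $\widehat\theta\to t$ of capacity $\partial f_\theta-\frac12\sum_{\theta'\in\mathcal R^{\mathcal F}_{\sf prop}(I)\setminus\{\theta\}}\partial^2f_{\theta,\theta'}+\gamma$ and an arc $s\to\widehat\theta$ of capacity $\gamma$, where $\gamma\ge0$ is any constant making all capacities of the arcs $\widehat\theta\to t$ non-negative. Conditions (ii), (iii) are read under (i), which makes their terms well defined. *)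

theory Defs
  imports
    "HOL-Algebra.Complete_Lattice"
    "HOL-Library.Extended_Real"
    "Graph_Theory.Digraph"
begin

section \<open>School matching instances and stable matchings\<close>

text \<open>
  The outside option is \<open>None\<close>; a student or school \<open>x\<close> is represented by \<open>Some x\<close>.
  \<open>(x, y) \<in> spref I a\<close> means that student \<open>a\<close> strictly prefers \<open>x\<close> to \<open>y\<close>, and
  similarly for \<open>cpref I b\<close> and school \<open>b\<close>.
\<close>

record ('a, 'b) school_instance =
  students :: "'a set"
  schools :: "'b set"
  spref :: "'a \<Rightarrow> 'b option rel"
  cpref :: "'b \<Rightarrow> 'a option rel"
  quota :: "'b \<Rightarrow> nat"

definition students_plus :: "('a, 'b) school_instance \<Rightarrow> 'a option set" where
  "students_plus I = insert None (Some ` students I)"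

definition schools_plus :: "('a, 'b) school_instance \<Rightarrow> 'b option set" where
  "schools_plus I = insert None (Some ` schools I)"

definition strict_total_order_on :: "'c set \<Rightarrow> 'c rel \<Rightarrow> bool" where
  "strict_total_order_on X r \<longleftrightarrow> r \<subseteq> X \<times> X \<and> strict_linear_order_on X r"

definition school_matching_instance :: "('a, 'b) school_instance \<Rightarrow> bool" where
  "school_matching_instance I \<longleftrightarrow>
     finite (students I) \<and> finite (schools I) \<and>
     (\<forall>a\<in>students I. strict_total_order_on (schools_plus I) (spref I a)) \<and>
     (\<forall>b\<in>schools I. strict_total_order_on (students_plus I) (cpref I b)) \<and>
     (\<forall>b\<in>schools I. quota I b \<le> card (students I))"

type_synonym ('a, 'b) matching = "('a option \<times> 'b option) set"

definition school_partners :: "('a, 'b) matching \<Rightarrow> 'b \<Rightarrow> 'a option set" where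
  "school_partners M b = {x. (x, Some b) \<in> M}"

definition student_partner :: "('a, 'b) matching \<Rightarrow> 'a \<Rightarrow> 'b option" where
  "student_partner M a = (THE y. (Some a, y) \<in> M)"

text \<open>
  A school that fills its quota is not paired with the outside option; a school with quota
  \<open>0\<close> has no partner at all.
\<close>

definition is_matching :: "('a, 'b) school_instance \<Rightarrow> ('a, 'b) matching \<Rightarrow> bool" where
  "is_matching I M \<longleftrightarrow>
     M \<subseteq> students_plus I \<times> schools_plus I - {(None, None)} \<and>
     (\<forall>a\<in>students I. \<exists>!y. (Some a, y) \<in> M) \<and>
     (\<forall>b\<in>schools I.
        (card (school_partners M b - {None}) = quota I b \<and> None \<notin> school_partners M b) \<or>
        (card (school_partners M b - {None}) < quota I b \<and> None \<in> school_partners M b))"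

definition stable_matchings :: "('a, 'b) school_instance \<Rightarrow> ('a, 'b) matching set" where
  "stable_matchings I = {M. is_matching I M \<and>
     \<not> (\<exists>a\<in>students I. \<exists>b\<in>schools I.
          (Some b, student_partner M a) \<in> spref I a \<and>
          (\<exists>x\<in>school_partners M b. (Some a, x) \<in> cpref I b)) \<and>
     \<not> (\<exists>a\<in>students I. (None, student_partner M a) \<in> spref I a) \<and>
     \<not> (\<exists>b\<in>schools I. \<exists>x\<in>school_partners M b. (None, x) \<in> cpref I b)}"

definition matching_ge ::
  "('a, 'b) school_instance \<Rightarrow> ('a, 'b) matching \<Rightarrow> ('a, 'b) matching \<Rightarrow> bool" where
  "matching_ge I M M' \<longleftrightarrow>
     (\<forall>a\<in>students I. student_partner M a = student_partner M' a \<or>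
        (student_partner M a, student_partner M' a) \<in> spref I a)"

definition stable_order :: "('a, 'b) school_instance \<Rightarrow> ('a, 'b) matching gorder" where
  "stable_order I =
     \<lparr>carrier = stable_matchings I, eq = (=), le = (\<lambda>M' M. matching_ge I M M')\<rparr>"

definition is_sublattice ::
  "('a, 'b) school_instance \<Rightarrow> ('a, 'b) matching set \<Rightarrow> bool" where
  "is_sublattice I F \<longleftrightarrow> F \<subseteq> stable_matchings I \<and>
     (\<forall>M\<in>F. \<forall>M'\<in>F. M \<squnion>\<^bsub>stable_order I\<^esub> M' \<in> F \<and> M \<sqinter>\<^bsub>stable_order I\<^esub> M' \<in> F)"

definition upper_closed :: "'c set \<Rightarrow> ('c \<Rightarrow> 'c \<Rightarrow> bool) \<Rightarrow> 'c set \<Rightarrow> bool" where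
  "upper_closed X ge U \<longleftrightarrow> U \<subseteq> X \<and> (\<forall>x\<in>U. \<forall>y\<in>X. ge y x \<longrightarrow> y \<in> U)"

section \<open>Rotations\<close>

definition immediate_predecessor ::
  "('a, 'b) school_instance \<Rightarrow> ('a, 'b) matching \<Rightarrow> ('a, 'b) matching \<Rightarrow> bool" where
  "immediate_predecessor I M' M \<longleftrightarrow>
     M' \<in> stable_matchings I \<and> M \<in> stable_matchings I \<and> M' \<sqsubset>\<^bsub>stable_order I\<^esub> M \<and>
     \<not> (\<exists>N\<in>stable_matchings I. M' \<sqsubset>\<^bsub>stable_order I\<^esub> N \<and> N \<sqsubset>\<^bsub>stable_order I\<^esub> M)"

type_synonym ('a, 'b) rotation = "('a, 'b) matching \<times> ('a, 'b) matching"

definition rotation :: "('a, 'b) matching \<Rightarrow> ('a, 'b) matching \<Rightarrow> ('a, 'b) rotation" where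
  "rotation M M' = (M - M', M' - M)"

definition exposed ::
  "('a, 'b) school_instance \<Rightarrow> ('a, 'b) rotation \<Rightarrow> ('a, 'b) matching \<Rightarrow> bool" where
  "exposed I \<rho> M \<longleftrightarrow> (\<exists>M'. immediate_predecessor I M' M \<and> \<rho> = rotation M M')"

definition rotations :: "('a, 'b) school_instance \<Rightarrow> ('a, 'b) rotation set" where
  "rotations I = {rotation M M' |M M'. immediate_predecessor I M' M}"

definition descending_chain ::
  "('a, 'b) school_instance \<Rightarrow> ('a, 'b) matching list \<Rightarrow> ('a, 'b) matching \<Rightarrow> bool" where
  "descending_chain I Ms M \<longleftrightarrow>
     Ms \<noteq> [] \<and> hd Ms = \<top>\<^bsub>stable_order I\<^esub> \<and> last Ms = M \<and>
     (\<forall>i. Suc i < length Ms \<longrightarrow> immediate_predecessor I (Ms ! Suc i) (Ms ! i))"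

text \<open>The set \<open>R\<^sub>M\<close>; the description is definite since the set does not depend on the chain.\<close>

definition rotation_set ::
  "('a, 'b) school_instance \<Rightarrow> ('a, 'b) matching \<Rightarrow> ('a, 'b) rotation set" where
  "rotation_set I M =
     (THE R. \<exists>Ms. descending_chain I Ms M \<and>
        R = {rotation (Ms ! i) (Ms ! Suc i) |i. Suc i < length Ms})"

definition rotation_ge ::
  "('a, 'b) school_instance \<Rightarrow> ('a, 'b) rotation \<Rightarrow> ('a, 'b) rotation \<Rightarrow> bool" where
  "rotation_ge I \<rho> \<rho>' \<longleftrightarrow>
     \<rho> = \<rho>' \<or> (\<forall>M\<in>stable_matchings I. exposed I \<rho>' M \<longrightarrow> \<rho> \<in> rotation_set I M)"

text \<open>\<open>M\<^sub>R\<close>, meaningful for upper-closed \<open>R\<close>.\<close>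

definition matching_of ::
  "('a, 'b) school_instance \<Rightarrow> ('a, 'b) rotation set \<Rightarrow> ('a, 'b) matching" where
  "matching_of I R = inv_into (stable_matchings I) (rotation_set I) R"

section \<open>Minimum cut representability\<close>

datatype 'r vertex = Source | Sink | Rot 'r

text \<open>Digraphs may have parallel arcs, each with its own capacity.\<close>

definition cut_capacity ::
  "('v, 'e) pre_digraph \<Rightarrow> ('e \<Rightarrow> ereal) \<Rightarrow> 'v set \<Rightarrow> ereal" where
  "cut_capacity D cap X = (\<Sum>e\<in>{e \<in> arcs D. tail D e \<in> X \<and> head D e \<notin> X}. cap e)"

definition witness_digraph ::
  "('a, 'b) school_instance \<Rightarrow> ('a, 'b) matching set \<Rightarrow> (('a, 'b) matching \<Rightarrow> real) \<Rightarrow>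
   (('a, 'b) rotation vertex, 'e) pre_digraph \<Rightarrow> ('e \<Rightarrow> ereal) \<Rightarrow> bool" where
  "witness_digraph I F f D cap \<longleftrightarrow>
     fin_digraph D \<and> verts D = {Source, Sink} \<union> Rot ` rotations I \<and>
     (\<forall>e\<in>arcs D. 0 \<le> cap e) \<and>
     (\<exists>C::real.
        (\<forall>R. R \<subseteq> rotations I \<longrightarrow>
           (cut_capacity D cap ({Source} \<union> Rot ` R) < \<infinity> \<longleftrightarrow>
            upper_closed (rotations I) (rotation_ge I) R \<and> matching_of I R \<in> F)) \<and>
        (\<forall>R. R \<subseteq> rotations I \<longrightarrow> cut_capacity D cap ({Source} \<union> Rot ` R) < \<infinity> \<longrightarrow>
           cut_capacity D cap ({Source} \<union> Rot ` R) = ereal (f (matching_of I R) + C)))"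

text \<open>Every finite digraph is, up to renaming of its arcs, one whose arcs are natural numbers.\<close>

definition min_cut_representable ::
  "('a, 'b) school_instance \<Rightarrow> ('a, 'b) matching set \<Rightarrow> (('a, 'b) matching \<Rightarrow> real) \<Rightarrow> bool" where
  "min_cut_representable I F f \<longleftrightarrow>
     (\<exists>(D :: (('a, 'b) rotation vertex, nat) pre_digraph) cap. witness_digraph I F f D cap)"

section \<open>Meta-rotations and differentials\<close>

definition meta_equiv ::
  "('a, 'b) school_instance \<Rightarrow> ('a, 'b) matching set \<Rightarrow> ('a, 'b) rotation rel" where
  "meta_equiv I F = {(\<rho>, \<rho>'). \<rho> \<in> rotations I \<and> \<rho>' \<in> rotations I \<and>
     (\<forall>M\<in>F. \<rho> \<in> rotation_set I M \<longleftrightarrow> \<rho>' \<in> rotation_set I M)}"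

definition theta_0 ::
  "('a, 'b) school_instance \<Rightarrow> ('a, 'b) matching set \<Rightarrow> ('a, 'b) rotation set" where
  "theta_0 I F = {\<rho> \<in> rotations I. \<forall>M\<in>F. \<rho> \<in> rotation_set I M}"

definition theta_z ::
  "('a, 'b) school_instance \<Rightarrow> ('a, 'b) matching set \<Rightarrow> ('a, 'b) rotation set" where
  "theta_z I F = {\<rho> \<in> rotations I. \<forall>M\<in>F. \<rho> \<notin> rotation_set I M}"

definition proper_meta_rotations ::
  "('a, 'b) school_instance \<Rightarrow> ('a, 'b) matching set \<Rightarrow> ('a, 'b) rotation set set" where
  "proper_meta_rotations I F = rotations I // meta_equiv I F - {theta_0 I F, theta_z I F}"

definition meta_rotations ::
  "('a, 'b) school_instance \<Rightarrow> ('a, 'b) matching set \<Rightarrow> ('a, 'b) rotation set set" where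
  "meta_rotations I F = proper_meta_rotations I F \<union> {theta_0 I F, theta_z I F}"

definition meta_ge ::
  "('a, 'b) school_instance \<Rightarrow> ('a, 'b) matching set \<Rightarrow>
   ('a, 'b) rotation set \<Rightarrow> ('a, 'b) rotation set \<Rightarrow> bool" where
  "meta_ge I F \<theta> \<theta>' \<longleftrightarrow> (\<forall>M\<in>F. \<theta>' \<subseteq> rotation_set I M \<longrightarrow> \<theta> \<subseteq> rotation_set I M)"

definition meta_gt ::
  "('a, 'b) school_instance \<Rightarrow> ('a, 'b) matching set \<Rightarrow>
   ('a, 'b) rotation set \<Rightarrow> ('a, 'b) rotation set \<Rightarrow> bool" where
  "meta_gt I F \<theta> \<theta>' \<longleftrightarrow> meta_ge I F \<theta> \<theta>' \<and> \<theta> \<noteq> \<theta>'"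

definition meta_set ::
  "('a, 'b) school_instance \<Rightarrow> ('a, 'b) matching set \<Rightarrow> ('a, 'b) matching \<Rightarrow>
   ('a, 'b) rotation set set" where
  "meta_set I F M = {\<theta> \<in> proper_meta_rotations I F. \<theta> \<subseteq> rotation_set I M}"

text \<open>
  \<open>M\<^sub>\<Theta>\<close>, meaningful for a non-empty sublattice \<open>F\<close> and upper-closed \<open>\<Theta>\<close>. The two
  matchings below it are \<open>M\<close> with superscript \<open>\<theta>\<close> (up-set of \<open>\<theta>\<close>) and \<open>M\<close> with
  subscript \<open>\<theta>\<close> (strict up-set of \<open>\<theta>\<close>).
\<close>

definition meta_matching ::
  "('a, 'b) school_instance \<Rightarrow> ('a, 'b) matching set \<Rightarrow> ('a, 'b) rotation set set \<Rightarrow>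
   ('a, 'b) matching" where
  "meta_matching I F \<Theta> = inv_into F (meta_set I F) \<Theta>"

definition M_up ::
  "('a, 'b) school_instance \<Rightarrow> ('a, 'b) matching set \<Rightarrow> ('a, 'b) rotation set \<Rightarrow>
   ('a, 'b) matching" where
  "M_up I F \<theta> = meta_matching I F {\<theta>' \<in> proper_meta_rotations I F. meta_ge I F \<theta>' \<theta>}"

definition M_down ::
  "('a, 'b) school_instance \<Rightarrow> ('a, 'b) matching set \<Rightarrow> ('a, 'b) rotation set \<Rightarrow>
   ('a, 'b) matching" where
  "M_down I F \<theta> = meta_matching I F {\<theta>' \<in> proper_meta_rotations I F. meta_gt I F \<theta>' \<theta>}"

definition diff1 ::
  "('a, 'b) school_instance \<Rightarrow> ('a, 'b) matching set \<Rightarrow> (('a, 'b) matching \<Rightarrow> real) \<Rightarrow>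
   ('a, 'b) rotation set \<Rightarrow> real" where
  "diff1 I F f \<theta> = f (M_up I F \<theta>) - f (M_down I F \<theta>)"

definition diff2 ::
  "('a, 'b) school_instance \<Rightarrow> ('a, 'b) matching set \<Rightarrow> (('a, 'b) matching \<Rightarrow> real) \<Rightarrow>
   ('a, 'b) rotation set \<Rightarrow> ('a, 'b) rotation set \<Rightarrow> real" where
  "diff2 I F f \<theta> \<theta>' =
     f (M_up I F \<theta> \<sqinter>\<^bsub>stable_order I\<^esub> M_down I F \<theta>')
     + f (M_down I F \<theta> \<sqinter>\<^bsub>stable_order I\<^esub> M_up I F \<theta>')
     - f (M_down I F \<theta> \<sqinter>\<^bsub>stable_order I\<^esub> M_down I F \<theta>')
     - f (M_up I F \<theta> \<sqinter>\<^bsub>stable_order I\<^esub> M_up I F \<theta>')"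

definition M_0F ::
  "('a, 'b) school_instance \<Rightarrow> ('a, 'b) matching set \<Rightarrow> ('a, 'b) matching" where
  "M_0F I F = \<Squnion>\<^bsub>stable_order I\<^esub> F"

section \<open>The cut digraph\<close>

text \<open>
  One constructor per kind of arc, so that the infinite-capacity arc \<open>Precede \<theta> \<theta>'\<close> and the
  finite-capacity arc \<open>Interact \<theta> \<theta>'\<close> are parallel arcs. The parameter \<open>rep\<close> of the tail and
  head functions selects the representative rotation of each meta-rotation.
\<close>

datatype 'r cut_arc =
    Within 'r 'r
  | Precede "'r set" "'r set"
  | Interact "'r set" "'r set"
  | SourceTrivial "'r set"
  | TrivialSink "'r set"
  | SourceProper "'r set"
  | ProperSink "'r set"

fun cut_arc_tail :: "('r set \<Rightarrow> 'r) \<Rightarrow> 'r cut_arc \<Rightarrow> 'r vertex" where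
  "cut_arc_tail rep (Within \<rho> \<rho>') = Rot \<rho>"
| "cut_arc_tail rep (Precede \<theta> \<theta>') = Rot (rep \<theta>)"
| "cut_arc_tail rep (Interact \<theta> \<theta>') = Rot (rep \<theta>)"
| "cut_arc_tail rep (SourceTrivial \<theta>) = Source"
| "cut_arc_tail rep (TrivialSink \<theta>) = Rot (rep \<theta>)"
| "cut_arc_tail rep (SourceProper \<theta>) = Source"
| "cut_arc_tail rep (ProperSink \<theta>) = Rot (rep \<theta>)"

fun cut_arc_head :: "('r set \<Rightarrow> 'r) \<Rightarrow> 'r cut_arc \<Rightarrow> 'r vertex" where
  "cut_arc_head rep (Within \<rho> \<rho>') = Rot \<rho>'"
| "cut_arc_head rep (Precede \<theta> \<theta>') = Rot (rep \<theta>')"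
| "cut_arc_head rep (Interact \<theta> \<theta>') = Rot (rep \<theta>')"
| "cut_arc_head rep (SourceTrivial \<theta>) = Rot (rep \<theta>)"
| "cut_arc_head rep (TrivialSink \<theta>) = Sink"
| "cut_arc_head rep (SourceProper \<theta>) = Rot (rep \<theta>)"
| "cut_arc_head rep (ProperSink \<theta>) = Sink"

definition cut_digraph ::
  "('a, 'b) school_instance \<Rightarrow> ('a, 'b) matching set \<Rightarrow>
   (('a, 'b) rotation set \<Rightarrow> ('a, 'b) rotation) \<Rightarrow>
   (('a, 'b) rotation vertex, ('a, 'b) rotation cut_arc) pre_digraph" where
  "cut_digraph I F rep =
     \<lparr>verts = {Source, Sink} \<union> Rot ` rotations I,
      arcs =
        {Within \<rho> \<rho>' |\<rho> \<rho>'. \<exists>\<theta>\<in>meta_rotations I F. \<rho> \<in> \<theta> \<and> \<rho>' \<in> \<theta> \<and> \<rho> \<noteq> \<rho>'} \<union>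
        {Precede \<theta> \<theta>' |\<theta> \<theta>'. \<theta> \<in> proper_meta_rotations I F \<and>
           \<theta>' \<in> proper_meta_rotations I F \<and> meta_gt I F \<theta>' \<theta>} \<union>
        {Interact \<theta> \<theta>' |\<theta> \<theta>'. \<theta> \<in> proper_meta_rotations I F \<and>
           \<theta>' \<in> proper_meta_rotations I F \<and> \<theta> \<noteq> \<theta>'} \<union>
        {SourceTrivial \<theta> |\<theta>. \<theta> = theta_0 I F \<and> \<theta> \<noteq> {}} \<union>
        {TrivialSink \<theta> |\<theta>. \<theta> = theta_z I F \<and> \<theta> \<noteq> {}} \<union>
        SourceProper ` proper_meta_rotations I F \<union>
        ProperSink ` proper_meta_rotations I F,
      tail = cut_arc_tail rep,
      head = cut_arc_head rep\<rparr>"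

definition sink_capacity ::
  "('a, 'b) school_instance \<Rightarrow> ('a, 'b) matching set \<Rightarrow> (('a, 'b) matching \<Rightarrow> real) \<Rightarrow> real \<Rightarrow>
   ('a, 'b) rotation set \<Rightarrow> real" where
  "sink_capacity I F f \<gamma> \<theta> =
     diff1 I F f \<theta> - 1/2 * (\<Sum>\<theta>'\<in>proper_meta_rotations I F - {\<theta>}. diff2 I F f \<theta> \<theta>') + \<gamma>"

fun cut_arc_capacity ::
  "('a, 'b) school_instance \<Rightarrow> ('a, 'b) matching set \<Rightarrow> (('a, 'b) matching \<Rightarrow> real) \<Rightarrow> real \<Rightarrow>
   ('a, 'b) rotation cut_arc \<Rightarrow> ereal" where
  "cut_arc_capacity I F f \<gamma> (Within \<rho> \<rho>') = \<infinity>"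
| "cut_arc_capacity I F f \<gamma> (Precede \<theta> \<theta>') = \<infinity>"
| "cut_arc_capacity I F f \<gamma> (Interact \<theta> \<theta>') = ereal (1/2 * diff2 I F f \<theta> \<theta>')"
| "cut_arc_capacity I F f \<gamma> (SourceTrivial \<theta>) = \<infinity>"
| "cut_arc_capacity I F f \<gamma> (TrivialSink \<theta>) = \<infinity>"
| "cut_arc_capacity I F f \<gamma> (SourceProper \<theta>) = ereal \<gamma>"
| "cut_arc_capacity I F f \<gamma> (ProperSink \<theta>) = ereal (sink_capacity I F f \<gamma> \<theta>)"

end

(*
For two stable matchings, letting every student keep the better (or every student the worse) of
the two partners gives a stable matching with the same number of students at every school. Hence
the welfare vectors of the stable matchings form a finite lattice under pointwise max and min, and
a stable matching lies, on the students moved by a given rotation, either entirely above or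
entirely below it. This yields the bijection between stable matchings and upper-closed sets of
rotations, and from it the one between a sublattice F and the up-sets of its meta-rotations.

Necessity: finite cuts are closed under union and intersection, so F is a sublattice. On the
finite cuts, the second difference of the capacity in two meta-rotations is the total capacity of
the arcs joining them. So it is non-negative and the same at every base point, and building up an
up-set one meta-rotation at a time gives the expansion of f into first and second differentials.

Sufficiency: the infinite arcs of the cut digraph cut out exactly the up-sets of meta-rotations,
and the finite arcs add up to the expansion, shifted by gamma times the number of proper
meta-rotations.
*)

theory Submission
  imports Defs
begin

section \<open>The lattice of stable matchings\<close>

text \<open>\<open>rotation_set\<close> is defined through a chain, which makes the sets of two
  matchings hard to compare. The proof replaces it by a chain-free test on the welfare of the
  students whom a rotation moves; independence of the chain, monotonicity and the union and
  intersection laws then become inequalities between naturals. Two comparable meta-rotations cannot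
  be added to an up-set in both orders, so no finite cuts exhibit a second difference for them: arcs
  of finite capacity may join them, and still their second differential vanishes. The expansion is
  therefore proved for functions on up-sets whose second difference is prescribed at incomparable
  pairs, and comparable pairs are shown to contribute nothing. The factor 1/2 reflects that an
  interaction is symmetric but is counted for both ordered pairs. The cut digraph deducts half of it
  at each of the two sink arcs: with both elements inside, the deductions add up to the whole
  interaction; with one inside, the crossing arc offsets the single deduction.\<close>

definition order_rank :: "'c rel \<Rightarrow> 'c \<Rightarrow> nat" where
  "order_rank r x = card (r `` {x})"

lemma order_rank_less:
  assumes "finite X" "strict_total_order_on X r" "(x, y) \<in> r"
  shows "order_rank r y < order_rank r x"
proof -
  have r: "r \<subseteq> X \<times> X" "trans r" "irrefl r"
    using assms(2) by (auto simp: strict_total_order_on_def strict_linear_order_on_def)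
  have "r `` {y} \<subset> r `` {x}"
    using r(2,3) assms(3) by (auto simp: irrefl_def dest: transD)
  moreover have "finite (r `` {x})"
    using r(1) assms(1) by (auto intro: finite_subset)
  ultimately show ?thesis unfolding order_rank_def by (rule psubset_card_mono[rotated])
qed

lemma order_rank_less_iff:
  assumes "finite X" "strict_total_order_on X r" "x \<in> X" "y \<in> X"
  shows "order_rank r y < order_rank r x \<longleftrightarrow> (x, y) \<in> r"
proof -
  have "x = y \<or> (x, y) \<in> r \<or> (y, x) \<in> r"
    using assms(2-4) by (auto simp: strict_total_order_on_def strict_linear_order_on_def total_on_def)
  then show ?thesis using order_rank_less[OF assms(1,2)] by (metis less_asym less_irrefl)
qed

lemma order_rank_inj:
  assumes "finite X" "strict_total_order_on X r" "x \<in> X" "y \<in> X" "order_rank r x = order_rank r y"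
  shows "x = y"
proof -
  have "x = y \<or> (x, y) \<in> r \<or> (y, x) \<in> r"
    using assms(2-4) by (auto simp: strict_total_order_on_def strict_linear_order_on_def total_on_def)
  then show ?thesis using order_rank_less[OF assms(1,2)] assms(5) by (metis less_irrefl)
qed

text \<open>Greedy choice: the best remaining element is added, and injectivity of \<open>v\<close>
  rules out ties. The \<open>min\<close> covers sets with fewer than \<open>q\<close> elements,
  which are taken whole.\<close>

lemma exists_top_subset:
  fixes v :: "'c \<Rightarrow> nat"
  assumes "finite X" "inj_on v X"
  shows "\<exists>L\<subseteq>X. card L = min q (card X) \<and> (\<forall>x\<in>L. \<forall>y\<in>X - L. v y < v x)"
proof (induction q)
  case 0
  then show ?case by (intro exI[of _ "{}"]) auto
next
  case (Suc q)
  then obtain L where L: "L \<subseteq> X" "card L = min q (card X)" "\<forall>x\<in>L. \<forall>y\<in>X - L. v y < v x"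
    by blast
  show ?case
  proof (cases "X - L = {}")
    case True
    then have "L = X" using L(1) by blast
    then show ?thesis using L by (intro exI[of _ X]) auto
  next
    case False
    have "finite (v ` (X - L))" "v ` (X - L) \<noteq> {}" using assms(1) False by auto
    then obtain m where m: "m \<in> X - L" "v m = Max (v ` (X - L))"
      using Max_in by (metis imageE)
    have mx: "v y \<le> v m" if "y \<in> X - L" for y
      using that m(2) \<open>finite (v ` (X - L))\<close> by auto
    have "card L < card X" using L(1) False assms(1) by (intro psubset_card_mono) auto
    then have "card (insert m L) = min (Suc q) (card X)"
      using L(2) m(1) finite_subset[OF L(1) assms(1)] by auto
    moreover have "v y < v m" if "y \<in> X - insert m L" for y
    proof -
      have "v y \<noteq> v m" using that m(1) assms(2) by (auto dest: inj_onD)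
      then show ?thesis using mx[of y] that by auto
    qed
    ultimately show ?thesis using L(1,3) m(1) by (intro exI[of _ "insert m L"]) auto
  qed
qed

section \<open>Stability expressed through the students' partners alone\<close>

locale school_market =
  fixes I :: "('a, 'b) school_instance"
  assumes market: "school_matching_instance I"
begin

text \<open>The rank counts the options that are worse, so larger is better. Preferences become
  inequalities between naturals, and the better or worse of two partners becomes \<open>max\<close>
  or \<open>min\<close>.\<close>

definition util :: "'a \<Rightarrow> 'b option \<Rightarrow> nat" where
  "util a = order_rank (spref I a)"

definition score :: "'b \<Rightarrow> 'a option \<Rightarrow> nat" where
  "score b = order_rank (cpref I b)"

definition assigned :: "('a \<Rightarrow> 'b option) \<Rightarrow> 'b \<Rightarrow> 'a set" where
  "assigned \<mu> b = {a \<in> students I. \<mu> a = Some b}"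

text \<open>Free seats are read off from the sizes of the \<open>assigned\<close> sets. A free seat
  acts like a partner \<open>None\<close>, so an acceptable student who prefers the school must find
  it full, with better students only. Testing acceptable students is enough: whoever is preferred to
  a free seat or to an acceptable partner is acceptable.\<close>

definition stable_assignment :: "('a \<Rightarrow> 'b option) \<Rightarrow> bool" where
  "stable_assignment \<mu> \<longleftrightarrow>
     (\<forall>a\<in>students I. \<mu> a \<in> schools_plus I \<and> util a None \<le> util a (\<mu> a)) \<and>
     (\<forall>b\<in>schools I. card (assigned \<mu> b) \<le> quota I b \<and>
        (\<forall>a\<in>assigned \<mu> b. score b None < score b (Some a)) \<and>
        (\<forall>a\<in>students I. util a (\<mu> a) < util a (Some b) \<longrightarrow> score b None < score b (Some a) \<longrightarrow>
           card (assigned \<mu> b) = quota I b \<and>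
           (\<forall>a'\<in>assigned \<mu> b. score b (Some a) < score b (Some a'))))"

lemma finite_students: "finite (students I)" and finite_schools: "finite (schools I)"
  using market by (auto simp: school_matching_instance_def)

lemma finite_students_plus: "finite (students_plus I)" and finite_schools_plus: "finite (schools_plus I)"
  using finite_students finite_schools by (auto simp: students_plus_def schools_plus_def)

lemma finite_assigned: "finite (assigned \<mu> b)"
  using finite_students by (auto simp: assigned_def)

lemma in_plus [simp]:
  "None \<in> students_plus I" "None \<in> schools_plus I"
  "Some a \<in> students_plus I \<longleftrightarrow> a \<in> students I" "Some b \<in> schools_plus I \<longleftrightarrow> b \<in> schools I"
  by (auto simp: students_plus_def schools_plus_def)

lemma util_less_iff:
  assumes "a \<in> students I" "x \<in> schools_plus I" "y \<in> schools_plus I"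
  shows "util a y < util a x \<longleftrightarrow> (x, y) \<in> spref I a"
  using order_rank_less_iff[OF finite_schools_plus _ assms(2,3)] market assms(1)
  by (auto simp: util_def school_matching_instance_def)

lemma util_inj:
  assumes "a \<in> students I" "x \<in> schools_plus I" "y \<in> schools_plus I" "util a x = util a y"
  shows "x = y"
  using order_rank_inj[OF finite_schools_plus _ assms(2,3)] market assms(1,4)
  by (auto simp: util_def school_matching_instance_def)

lemma score_less_iff:
  assumes "b \<in> schools I" "x \<in> students_plus I" "y \<in> students_plus I"
  shows "score b y < score b x \<longleftrightarrow> (x, y) \<in> cpref I b"
  using order_rank_less_iff[OF finite_students_plus _ assms(2,3)] market assms(1)
  by (auto simp: score_def school_matching_instance_def)

lemma score_inj:
  assumes "b \<in> schools I" "x \<in> students_plus I" "y \<in> students_plus I" "score b x = score b y"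
  shows "x = y"
  using order_rank_inj[OF finite_students_plus _ assms(2,3)] market assms(1,4)
  by (auto simp: score_def school_matching_instance_def)

lemma pair_mem_iff:
  assumes "is_matching I M" "a \<in> students I"
  shows "(Some a, y) \<in> M \<longleftrightarrow> y = student_partner M a"
proof -
  have "\<exists>!y. (Some a, y) \<in> M" using assms by (simp add: is_matching_def)
  then show ?thesis unfolding student_partner_def by (metis theI')
qed

lemma partner_in_plus:
  assumes "is_matching I M" "a \<in> students I"
  shows "student_partner M a \<in> schools_plus I"
  using pair_mem_iff[OF assms, of "student_partner M a"] assms(1)
  by (auto simp: is_matching_def)

lemma school_partners_students:
  assumes "is_matching I M"
  shows "school_partners M b - {None} = Some ` assigned (student_partner M) b"
proof (intro subset_antisym subsetI)
  fix x assume "x \<in> school_partners M b - {None}"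
  then obtain a where a: "x = Some a" "(Some a, Some b) \<in> M" by (cases x) (auto simp: school_partners_def)
  then have "a \<in> students I" using assms by (auto simp: is_matching_def)
  then show "x \<in> Some ` assigned (student_partner M) b"
    using a pair_mem_iff[OF assms] by (auto simp: assigned_def)
next
  fix x assume "x \<in> Some ` assigned (student_partner M) b"
  then show "x \<in> school_partners M b - {None}"
    using pair_mem_iff[OF assms] by (auto simp: assigned_def school_partners_def)
qed

lemma assigned_quota:
  assumes "is_matching I M" "b \<in> schools I"
  shows "card (assigned (student_partner M) b) \<le> quota I b"
    and "(None, Some b) \<in> M \<longleftrightarrow> card (assigned (student_partner M) b) < quota I b"
proof -
  have c: "card (school_partners M b - {None}) = card (assigned (student_partner M) b)"
    unfolding school_partners_students[OF assms(1)] by (rule card_image) simp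
  have "(card (school_partners M b - {None}) = quota I b \<and> None \<notin> school_partners M b) \<or>
        (card (school_partners M b - {None}) < quota I b \<and> None \<in> school_partners M b)"
    using assms by (auto simp: is_matching_def)
  then show "card (assigned (student_partner M) b) \<le> quota I b"
    "(None, Some b) \<in> M \<longleftrightarrow> card (assigned (student_partner M) b) < quota I b"
    unfolding c by (auto simp: school_partners_def)
qed

text \<open>The pairs with the outside option are recovered from the number of students at each
  school, so the students' partners determine the whole set of pairs.\<close>

lemma matching_eqI:
  assumes "is_matching I M" "is_matching I M'"
    and "\<And>a. a \<in> students I \<Longrightarrow> student_partner M a = student_partner M' a"
  shows "M = M'"
proof -
  have *: "N \<subseteq> N'" if N: "is_matching I N" "is_matching I N'"
    "\<And>a. a \<in> students I \<Longrightarrow> student_partner N a = student_partner N' a" for N N'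
  proof (rule subrelI)
    fix x y assume xy: "(x, y) \<in> N"
    have as: "assigned (student_partner N) b = assigned (student_partner N') b" for b
      using N(3) by (auto simp: assigned_def)
    show "(x, y) \<in> N'"
    proof (cases x)
      case None
      then obtain b where "y = Some b" "b \<in> schools I" using xy N(1) by (cases y) (auto simp: is_matching_def)
      then show ?thesis using None xy assigned_quota(2)[OF N(1)] assigned_quota(2)[OF N(2)] as by simp
    next
      case (Some a)
      then have "a \<in> students I" using xy N(1) by (auto simp: is_matching_def)
      then show ?thesis using Some xy pair_mem_iff N by metis
    qed
  qed
  show ?thesis using *[of M M'] *[of M' M] assms by auto
qed

lemma stable_is_matching: "M \<in> stable_matchings I \<Longrightarrow> is_matching I M"
  by (simp add: stable_matchings_def)

lemma stable_assignment_partner: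
  assumes M: "M \<in> stable_matchings I"
  shows "stable_assignment (student_partner M)"
proof -
  let ?\<mu> = "student_partner M"
  have m: "is_matching I M" by (rule stable_is_matching[OF M])
  have ir: "util a None \<le> util a (?\<mu> a)" if "a \<in> students I" for a
    using M that util_less_iff[OF that partner_in_plus[OF m that], of None]
      util_less_iff[OF that _ partner_in_plus[OF m that], of None]
    by (auto simp: stable_matchings_def not_less[symmetric])
  have acc: "score b None < score b (Some a)" if "b \<in> schools I" "a \<in> assigned ?\<mu> b" for a b
  proof -
    have a: "a \<in> students I" using that by (simp add: assigned_def)
    have "Some a \<in> school_partners M b"
      using that school_partners_students[OF m, of b] by auto
    then have "(None, Some a) \<notin> cpref I b" using M that(1) by (auto simp: stable_matchings_def)
    then have "\<not> score b (Some a) < score b None" using that(1) a by (simp add: score_less_iff)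
    moreover have "score b (Some a) \<noteq> score b None"
      using score_inj[of b "Some a" None] that(1) a by auto
    ultimately show ?thesis by simp
  qed
  have bl: "card (assigned ?\<mu> b) = quota I b \<and> (\<forall>a'\<in>assigned ?\<mu> b. score b (Some a) < score b (Some a'))"
    if b: "b \<in> schools I" and a: "a \<in> students I" and u: "util a (?\<mu> a) < util a (Some b)"
      and s: "score b None < score b (Some a)" for a b
  proof -
    have "(Some b, ?\<mu> a) \<in> spref I a"
      using u util_less_iff[OF a _ partner_in_plus[OF m a]] b by auto
    then have nb: "\<forall>x\<in>school_partners M b. (Some a, x) \<notin> cpref I b"
      using M a b by (auto simp: stable_matchings_def)
    have "(Some a, None) \<in> cpref I b" using s b a by (simp add: score_less_iff)
    \<comment> \<open>An acceptable student who prefers the school would block together with a free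
      seat.\<close>
    then have "(None, Some b) \<notin> M" using nb by (auto simp: school_partners_def)
    then have "card (assigned ?\<mu> b) = quota I b"
      using assigned_quota[OF m b] by simp
    moreover have "score b (Some a) < score b (Some a')" if a': "a' \<in> assigned ?\<mu> b" for a'
    proof -
      have s': "a' \<in> students I" using a' by (simp add: assigned_def)
      have "Some a' \<in> school_partners M b" using a' school_partners_students[OF m, of b] by auto
      then have "\<not> score b (Some a') < score b (Some a)" using nb b a s' by (simp add: score_less_iff)
      moreover have "score b (Some a') \<noteq> score b (Some a)"
        using score_inj[of b "Some a'" "Some a"] b a s' a' u by (auto simp: assigned_def)
      ultimately show ?thesis by simp
    qed
    ultimately show ?thesis by simp
  qed
  show ?thesis unfolding stable_assignment_def
    using ir acc bl partner_in_plus[OF m] assigned_quota(1)[OF m] by blast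
qed

lemma stable_matching_of_assignment:
  assumes \<mu>: "stable_assignment \<mu>"
  obtains M where "M \<in> stable_matchings I" "\<And>a. a \<in> students I \<Longrightarrow> student_partner M a = \<mu> a"
proof -
  \<comment> \<open>The pairs with the outside option are dictated by the quota rule: one for each
    school with a free seat.\<close>
  define M where "M = {(Some a, \<mu> a) |a. a \<in> students I} \<union>
    {(None, Some b) |b. b \<in> schools I \<and> card (assigned \<mu> b) < quota I b}"
  have pl: "\<mu> a \<in> schools_plus I" and ir: "util a None \<le> util a (\<mu> a)" if "a \<in> students I" for a
    using \<mu> that by (auto simp: stable_assignment_def)
  have q: "card (assigned \<mu> b) \<le> quota I b" and acc: "\<forall>a\<in>assigned \<mu> b. score b None < score b (Some a)"
    and bl: "\<And>a. a \<in> students I \<Longrightarrow> util a (\<mu> a) < util a (Some b) \<Longrightarrow>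
      score b None < score b (Some a) \<Longrightarrow>
      card (assigned \<mu> b) = quota I b \<and> (\<forall>a'\<in>assigned \<mu> b. score b (Some a) < score b (Some a'))"
    if "b \<in> schools I" for b
    using \<mu> that by (auto simp: stable_assignment_def)
  have sp: "school_partners M b = Some ` assigned \<mu> b \<union>
     (if card (assigned \<mu> b) < quota I b then {None} else {})" if "b \<in> schools I" for b
    using that by (auto simp: M_def school_partners_def assigned_def)
  have spd: "school_partners M b - {None} = Some ` assigned \<mu> b" if "b \<in> schools I" for b
    unfolding sp[OF that] by auto
  have cd: "card (school_partners M b - {None}) = card (assigned \<mu> b)" if "b \<in> schools I" for b
    unfolding spd[OF that] by (rule card_image) simp
  have m: "is_matching I M"
    unfolding is_matching_def
  proof (intro conjI ballI)
    show "M \<subseteq> students_plus I \<times> schools_plus I - {(None, None)}"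
      using pl by (auto simp: M_def)
    show "\<exists>!y. (Some a, y) \<in> M" if "a \<in> students I" for a
      using that by (auto simp: M_def)
    show "(card (school_partners M b - {None}) = quota I b \<and> None \<notin> school_partners M b) \<or>
        (card (school_partners M b - {None}) < quota I b \<and> None \<in> school_partners M b)"
      if "b \<in> schools I" for b
      unfolding cd[OF that] using q[OF that] by (auto simp: sp[OF that])
  qed
  have p: "student_partner M a = \<mu> a" if "a \<in> students I" for a
  proof -
    have "(Some a, \<mu> a) \<in> M" using that by (auto simp: M_def)
    then show ?thesis using pair_mem_iff[OF m that] by simp
  qed
  have "M \<in> stable_matchings I"
    unfolding stable_matchings_def mem_Collect_eq
  proof (intro conjI notI m; elim bexE conjE)
    fix a b x assume a: "a \<in> students I" and b: "b \<in> schools I"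
      and pr: "(Some b, student_partner M a) \<in> spref I a"
      and x: "x \<in> school_partners M b" "(Some a, x) \<in> cpref I b"
    have u: "util a (\<mu> a) < util a (Some b)"
      using pr p[OF a] util_less_iff[OF a, of "Some b" "\<mu> a"] pl[OF a] b by simp
    have xp: "x \<in> students_plus I" using x(1) sp[OF b] by (auto simp: assigned_def split: if_splits)
    have sx: "score b x < score b (Some a)" using x(2) score_less_iff[OF b _ xp, of "Some a"] a by simp
    have "score b None < score b (Some a)"
      using x(1) sx acc[OF b] sp[OF b] by (cases x) (auto split: if_splits)
    then show False using bl[OF b a u] x(1) sx sp[OF b] by (cases x) (auto split: if_splits)
  next
    fix a assume a: "a \<in> students I" and "(None, student_partner M a) \<in> spref I a"
    then have "util a (\<mu> a) < util a None" using util_less_iff[OF a, of None "\<mu> a"] pl[OF a] p[OF a] by simp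
    then show False using ir[OF a] by simp
  next
    fix b x assume b: "b \<in> schools I" and x: "x \<in> school_partners M b" "(None, x) \<in> cpref I b"
    have xp: "x \<in> students_plus I" using x(1) sp[OF b] by (auto simp: assigned_def split: if_splits)
    have sx: "score b x < score b None" using x(2) score_less_iff[OF b _ xp, of None] by simp
    show False using x(1) sx acc[OF b] sp[OF b] by (cases x) (auto split: if_splits)
  qed
  then show ?thesis using p that by blast
qed

section \<open>Pointwise minimum and maximum of stable assignments\<close>

definition lower :: "('a \<Rightarrow> 'b option) \<Rightarrow> ('a \<Rightarrow> 'b option) \<Rightarrow> 'a \<Rightarrow> 'b option" where
  "lower \<mu> \<nu> a = (if util a (\<mu> a) \<le> util a (\<nu> a) then \<mu> a else \<nu> a)"

definition upper :: "('a \<Rightarrow> 'b option) \<Rightarrow> ('a \<Rightarrow> 'b option) \<Rightarrow> 'a \<Rightarrow> 'b option" where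
  "upper \<mu> \<nu> a = (if util a (\<mu> a) \<le> util a (\<nu> a) then \<nu> a else \<mu> a)"

lemma util_lower: "util a (lower \<mu> \<nu> a) = min (util a (\<mu> a)) (util a (\<nu> a))"
  and util_upper: "util a (upper \<mu> \<nu> a) = max (util a (\<mu> a)) (util a (\<nu> a))"
  by (auto simp: lower_def upper_def)

text \<open>Double counting: the sizes at the schools can be compared through the set of students
  who are not left with the outside option.\<close>

lemma sum_card_assigned:
  assumes "\<And>a. a \<in> students I \<Longrightarrow> \<mu> a \<in> schools_plus I"
  shows "(\<Sum>b\<in>schools I. card (assigned \<mu> b)) = card {a \<in> students I. \<mu> a \<noteq> None}"
proof -
  have "{a \<in> students I. \<mu> a \<noteq> None} = (\<Union>b\<in>schools I. assigned \<mu> b)"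
    using assms by (force simp: assigned_def schools_plus_def)
  moreover have "card (\<Union>b\<in>schools I. assigned \<mu> b) = (\<Sum>b\<in>schools I. card (assigned \<mu> b))"
    by (rule card_UN_disjoint) (use finite_schools finite_assigned in \<open>auto simp: assigned_def\<close>)
  ultimately show ?thesis by simp
qed

text \<open>If \<open>a\<close> preferred \<open>b\<close> to its own partner, \<open>b\<close>
  would be full under \<nu> with students ranked above \<open>a\<close>. Students outside
  \<open>L\<close> rank below \<open>a\<close>, so they would all lie in \<open>L\<close>; together
  with \<open>a\<close> itself, \<open>L\<close> would exceed the quota.\<close>

lemma chosen_not_better_off:
  assumes \<nu>: "stable_assignment \<nu>" and b: "b \<in> schools I"
    and L: "finite L" "card L \<le> quota I b" "\<And>y. y \<in> assigned \<nu> b - L \<Longrightarrow> score b (Some y) < score b (Some a)"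
    and a: "a \<in> L" "a \<in> students I" "a \<notin> assigned \<nu> b" "score b None < score b (Some a)"
  shows "util a (Some b) \<le> util a (\<nu> a)"
proof (rule ccontr)
  assume "\<not> ?thesis"
  then have bl: "card (assigned \<nu> b) = quota I b"
    "\<forall>a'\<in>assigned \<nu> b. score b (Some a) < score b (Some a')"
    using \<nu> b a(2,4) by (auto simp: stable_assignment_def)
  then have "assigned \<nu> b \<subseteq> L" using L(3) by (meson DiffI less_asym subsetI)
  then have "insert a (assigned \<nu> b) \<subseteq> L" using a(1) by blast
  then have "card (insert a (assigned \<nu> b)) \<le> card L" using L(1) by (rule card_mono[rotated])
  then show False using a(3) bl(1) L(2) finite_assigned by auto
qed

text \<open>
  Let \<open>L b\<close> be the best \<open>q\<^sub>b\<close> students among those assigned to \<open>b\<close> by \<open>\<mu>\<close> or \<open>\<nu>\<close>. Stability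
  forces every student of \<open>L b\<close> to get \<open>b\<close> as the worse of the two partners. Summed over the
  schools, \<open>|\<mu>(b)| \<le> |L b| \<le> |lower(b)|\<close> and the last total is at most the first, so all three agree.
\<close>

lemma lower_assigned:
  assumes \<mu>: "stable_assignment \<mu>" and \<nu>: "stable_assignment \<nu>" and b: "b \<in> schools I"
  shows "card (assigned (lower \<mu> \<nu>) b) = card (assigned \<mu> b)"
    and "\<And>x y. x \<in> assigned (lower \<mu> \<nu>) b \<Longrightarrow> y \<in> assigned \<mu> b \<union> assigned \<nu> b \<Longrightarrow>
           y \<notin> assigned (lower \<mu> \<nu>) b \<Longrightarrow> score b (Some y) < score b (Some x)"
proof -
  have "\<exists>L. L \<subseteq> assigned \<mu> b \<union> assigned \<nu> b \<and>
      card L = min (quota I b) (card (assigned \<mu> b \<union> assigned \<nu> b)) \<and>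
      (\<forall>x\<in>L. \<forall>y\<in>assigned \<mu> b \<union> assigned \<nu> b - L. score b (Some y) < score b (Some x))"
    if b: "b \<in> schools I" for b
  proof -
    have "inj_on (\<lambda>x. score b (Some x)) (assigned \<mu> b \<union> assigned \<nu> b)"
      using score_inj[OF b in_plus(3)[THEN iffD2] in_plus(3)[THEN iffD2]]
      by (intro inj_onI) (fastforce simp: assigned_def)
    then show ?thesis
      using exists_top_subset[of "assigned \<mu> b \<union> assigned \<nu> b" "\<lambda>x. score b (Some x)" "quota I b"]
        finite_assigned by auto
  qed
  then obtain L where L: "\<And>b. b \<in> schools I \<Longrightarrow> L b \<subseteq> assigned \<mu> b \<union> assigned \<nu> b"
    "\<And>b. b \<in> schools I \<Longrightarrow> card (L b) = min (quota I b) (card (assigned \<mu> b \<union> assigned \<nu> b))"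
    "\<And>b x y. b \<in> schools I \<Longrightarrow> x \<in> L b \<Longrightarrow> y \<in> assigned \<mu> b \<union> assigned \<nu> b \<Longrightarrow> y \<notin> L b \<Longrightarrow>
       score b (Some y) < score b (Some x)"
    by (metis DiffI)
  have Lf: "finite (L b)" if "b \<in> schools I" for b
    using L(1)[OF that] finite_assigned by (meson finite_Un finite_subset)
  have Lq: "card (L b) \<le> quota I b" if "b \<in> schools I" for b using L(2)[OF that] by simp
  have pl: "\<mu> a \<in> schools_plus I" "\<nu> a \<in> schools_plus I" if "a \<in> students I" for a
    using \<mu> \<nu> that by (auto simp: stable_assignment_def)
  have LW: "L b \<subseteq> assigned (lower \<mu> \<nu>) b" if b: "b \<in> schools I" for b
  proof
    fix a assume a: "a \<in> L b"
    have u: "a \<in> assigned \<mu> b \<union> assigned \<nu> b" using a L(1)[OF b] by blast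
    have as: "a \<in> students I" using u by (auto simp: assigned_def)
    have acc: "score b None < score b (Some a)"
      using u \<mu> \<nu> b by (auto simp: stable_assignment_def)
    have 1: "util a (Some b) \<le> util a (\<nu> a)" if "a \<notin> assigned \<nu> b"
      by (rule chosen_not_better_off[OF \<nu> b Lf[OF b] Lq[OF b] _ a as that acc])
        (use L(3)[OF b a] in auto)
    have 2: "util a (Some b) \<le> util a (\<mu> a)" if "a \<notin> assigned \<mu> b"
      by (rule chosen_not_better_off[OF \<mu> b Lf[OF b] Lq[OF b] _ a as that acc])
        (use L(3)[OF b a] in auto)
    have "util a (Some b) = util a (lower \<mu> \<nu> a)"
      using u 1 2 unfolding util_lower by (cases "a \<in> assigned \<mu> b"; cases "a \<in> assigned \<nu> b") (auto simp: assigned_def)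
    then have "lower \<mu> \<nu> a = Some b"
      using util_inj[OF as, of "Some b" "lower \<mu> \<nu> a"] pl[OF as] b by (auto simp: lower_def)
    then show "a \<in> assigned (lower \<mu> \<nu>) b" using as by (simp add: assigned_def)
  qed
  have \<mu>L: "card (assigned \<mu> b) \<le> card (L b)" if b: "b \<in> schools I" for b
  proof -
    have "card (assigned \<mu> b) \<le> card (assigned \<mu> b \<union> assigned \<nu> b)"
      by (rule card_mono) (auto simp: finite_assigned)
    moreover have "card (assigned \<mu> b) \<le> quota I b" using \<mu> b by (auto simp: stable_assignment_def)
    ultimately show ?thesis using L(2)[OF b] by simp
  qed
  have LWc: "card (L b) \<le> card (assigned (lower \<mu> \<nu>) b)" if "b \<in> schools I" for b
    using LW[OF that] finite_assigned by (rule card_mono[rotated])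
  \<comment> \<open>By individual rationality of \<nu>, the outside option is never better than the
    partner under \<nu>, so a student unassigned by \<mu> stays unassigned in the pointwise
    minimum.\<close>
  have "{a \<in> students I. lower \<mu> \<nu> a \<noteq> None} \<subseteq> {a \<in> students I. \<mu> a \<noteq> None}"
  proof (rule subsetI, rule ccontr)
    fix a assume a: "a \<in> {a \<in> students I. lower \<mu> \<nu> a \<noteq> None}" "a \<notin> {a \<in> students I. \<mu> a \<noteq> None}"
    then have "util a None \<le> util a (\<nu> a)" using \<nu> by (auto simp: stable_assignment_def)
    then show False using a by (simp add: lower_def)
  qed
  then have "card {a \<in> students I. lower \<mu> \<nu> a \<noteq> None} \<le> card {a \<in> students I. \<mu> a \<noteq> None}"
    using finite_students by (intro card_mono) auto
  then have le: "(\<Sum>b\<in>schools I. card (assigned (lower \<mu> \<nu>) b)) \<le> (\<Sum>b\<in>schools I. card (assigned \<mu> b))"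
    using sum_card_assigned[of \<mu>] sum_card_assigned[of "lower \<mu> \<nu>"] pl by (auto simp: lower_def)
  have eq: "card (assigned \<mu> b) = card (assigned (lower \<mu> \<nu>) b)" if "b \<in> schools I" for b
  proof (rule sum_mono_inv[OF _ _ that finite_schools, of _ "\<lambda>b. card (assigned (lower \<mu> \<nu>) b)"])
    show le': "card (assigned \<mu> b) \<le> card (assigned (lower \<mu> \<nu>) b)" if "b \<in> schools I" for b
      using \<mu>L LWc that le_trans by blast
    show "(\<Sum>b\<in>schools I. card (assigned \<mu> b)) = (\<Sum>b\<in>schools I. card (assigned (lower \<mu> \<nu>) b))"
      by (rule antisym[OF sum_mono le]) (rule le')
  qed
  then show "card (assigned (lower \<mu> \<nu>) b) = card (assigned \<mu> b)" using b by simp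
  have "L b = assigned (lower \<mu> \<nu>) b"
    using LW[OF b] \<mu>L[OF b] eq[OF b] by (intro card_seteq) (auto simp: finite_assigned)
  then show "score b (Some y) < score b (Some x)"
    if "x \<in> assigned (lower \<mu> \<nu>) b" "y \<in> assigned \<mu> b \<union> assigned \<nu> b"
      "y \<notin> assigned (lower \<mu> \<nu>) b" for x y
    using L(3)[OF b] that by blast
qed

text \<open>The size of the minimum at a school is that of the first argument. The minimum is
  symmetric, so exchanging the arguments equates the two sizes.\<close>

lemma rural_hospitals:
  assumes \<mu>: "stable_assignment \<mu>" and \<nu>: "stable_assignment \<nu>" and b: "b \<in> schools I"
  shows "card (assigned \<mu> b) = card (assigned \<nu> b)"
proof -
  \<comment> \<open>A tie in utility means equal partners, so the tie-breaking in
    \<open>lower\<close> has no effect.\<close>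
  have "lower \<mu> \<nu> a = lower \<nu> \<mu> a" if "a \<in> students I" for a
    using util_inj[OF that, of "\<mu> a" "\<nu> a"] \<mu> \<nu> that
    by (auto simp: lower_def stable_assignment_def)
  then have "assigned (lower \<mu> \<nu>) b = assigned (lower \<nu> \<mu>) b"
    by (auto simp: assigned_def)
  then show ?thesis using lower_assigned(1)[OF \<mu> \<nu> b] lower_assigned(1)[OF \<nu> \<mu> b] by simp
qed

text \<open>Each student's two partners are merely distributed over the minimum and the maximum.
  Counting both sides gives the size of the maximum at a school once that of the minimum is
  known.\<close>

lemma assigned_Un_Int:
  "assigned (upper \<mu> \<nu>) b \<union> assigned (lower \<mu> \<nu>) b = assigned \<mu> b \<union> assigned \<nu> b"
  "assigned (upper \<mu> \<nu>) b \<inter> assigned (lower \<mu> \<nu>) b = assigned \<mu> b \<inter> assigned \<nu> b"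
  by (auto simp: assigned_def upper_def lower_def)

text \<open>A student blocking with \<open>b\<close> already prefers \<open>b\<close> to the partner
  under one of the two assignments, so there \<open>b\<close> is full of better students. A student
  \<open>x\<close> newly at \<open>b\<close> displaces some \<open>y\<close> of these, by equality
  of sizes, and \<open>x\<close> ranks above \<open>y\<close> by the second part of
  \<open>lower_assigned\<close>.\<close>

lemma stable_lower:
  assumes \<mu>: "stable_assignment \<mu>" and \<nu>: "stable_assignment \<nu>"
  shows "stable_assignment (lower \<mu> \<nu>)"
proof -
  have bl: "card (assigned (lower \<mu> \<nu>) b) = quota I b \<and>
      (\<forall>a'\<in>assigned (lower \<mu> \<nu>) b. score b (Some a) < score b (Some a'))"
    if b: "b \<in> schools I" and a: "a \<in> students I" "util a (lower \<mu> \<nu> a) < util a (Some b)"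
      "score b None < score b (Some a)" for a b
  proof -
    have *: "?thesis" if \<xi>: "stable_assignment \<xi>" "\<xi> = \<mu> \<or> \<xi> = \<nu>" "util a (\<xi> a) < util a (Some b)" for \<xi>
    proof -
      have f: "card (assigned \<xi> b) = quota I b" "\<forall>a'\<in>assigned \<xi> b. score b (Some a) < score b (Some a')"
        using \<xi> b a by (auto simp: stable_assignment_def)
      have c: "card (assigned (lower \<mu> \<nu>) b) = card (assigned \<xi> b)"
        using lower_assigned(1)[OF \<mu> \<nu> b] rural_hospitals[OF \<mu> \<xi>(1) b] by simp
      have "score b (Some a) < score b (Some x)" if x: "x \<in> assigned (lower \<mu> \<nu>) b" for x
      proof (cases "x \<in> assigned \<xi> b")
        case False
        then have "\<not> assigned \<xi> b \<subseteq> assigned (lower \<mu> \<nu>) b"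
          using card_seteq[of "assigned (lower \<mu> \<nu>) b" "assigned \<xi> b"] c finite_assigned x by auto
        then obtain y where y: "y \<in> assigned \<xi> b" "y \<notin> assigned (lower \<mu> \<nu>) b" by blast
        then have "score b (Some y) < score b (Some x)"
          using lower_assigned(2)[OF \<mu> \<nu> b x, of y] \<xi>(2) by blast
        then show ?thesis using f(2) y(1) by force
      qed (use f in auto)
      then show ?thesis using c f(1) by simp
    qed
    show ?thesis using *[OF \<mu>] *[OF \<nu>] a(2) unfolding util_lower by (auto simp: min_def split: if_splits)
  qed
  have q: "card (assigned (lower \<mu> \<nu>) b) \<le> quota I b" if "b \<in> schools I" for b
    using lower_assigned(1)[OF \<mu> \<nu> that] \<mu> that by (auto simp: stable_assignment_def)
  have acc: "score b None < score b (Some a)" if "b \<in> schools I" "a \<in> assigned (lower \<mu> \<nu>) b" for a b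
    using that \<mu> \<nu> by (auto simp: stable_assignment_def assigned_def lower_def split: if_splits)
  show ?thesis unfolding stable_assignment_def
    using bl q acc \<mu> \<nu> by (auto simp: stable_assignment_def lower_def)
qed

text \<open>A blocking student would prefer \<open>b\<close> to both partners, so both assignments
  fill \<open>b\<close> with better students; the maximum draws its students at \<open>b\<close>
  from these two sets and has the same size.\<close>

lemma stable_upper:
  assumes \<mu>: "stable_assignment \<mu>" and \<nu>: "stable_assignment \<nu>"
  shows "stable_assignment (upper \<mu> \<nu>)"
proof -
  have c: "card (assigned (upper \<mu> \<nu>) b) = card (assigned \<mu> b)" if b: "b \<in> schools I" for b
  proof -
    have "card (assigned (upper \<mu> \<nu>) b) + card (assigned (lower \<mu> \<nu>) b) = card (assigned \<mu> b) + card (assigned \<nu> b)"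
      by (metis card_Un_Int finite_assigned assigned_Un_Int)
    then show ?thesis
      using lower_assigned(1)[OF \<mu> \<nu> b] rural_hospitals[OF \<mu> \<nu> b] by simp
  qed
  have bl: "card (assigned (upper \<mu> \<nu>) b) = quota I b \<and>
      (\<forall>a'\<in>assigned (upper \<mu> \<nu>) b. score b (Some a) < score b (Some a'))"
    if b: "b \<in> schools I" and a: "a \<in> students I" "util a (upper \<mu> \<nu> a) < util a (Some b)"
      "score b None < score b (Some a)" for a b
  proof -
    have *: "card (assigned \<xi> b) = quota I b \<and> (\<forall>a'\<in>assigned \<xi> b. score b (Some a) < score b (Some a'))"
      if "stable_assignment \<xi>" "util a (\<xi> a) < util a (Some b)" for \<xi>
      using that b a by (auto simp: stable_assignment_def)
    have "assigned (upper \<mu> \<nu>) b \<subseteq> assigned \<mu> b \<union> assigned \<nu> b" by (auto simp: assigned_def upper_def)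
    then show ?thesis using *[OF \<mu>] *[OF \<nu>] a(2) c[OF b] unfolding util_upper by auto
  qed
  have q: "card (assigned (upper \<mu> \<nu>) b) \<le> quota I b" if "b \<in> schools I" for b
    using c[OF that] \<mu> that by (auto simp: stable_assignment_def)
  have acc: "score b None < score b (Some a)" if "b \<in> schools I" "a \<in> assigned (upper \<mu> \<nu>) b" for a b
    using that \<mu> \<nu> by (auto simp: stable_assignment_def assigned_def upper_def split: if_splits)
  show ?thesis unfolding stable_assignment_def
    using bl q acc \<mu> \<nu> by (auto simp: stable_assignment_def upper_def)
qed

section \<open>Stable matchings ordered by their welfare vectors\<close>

abbreviation S :: "('a, 'b) matching set" where "S \<equiv> stable_matchings I"

definition welfare :: "('a, 'b) matching \<Rightarrow> 'a \<Rightarrow> nat" where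
  "welfare M a = util a (student_partner M a)"

lemma partner_eq_iff:
  assumes "M \<in> S" "N \<in> S" "a \<in> students I"
  shows "student_partner M a = student_partner N a \<longleftrightarrow> welfare M a = welfare N a"
  using util_inj[OF assms(3) partner_in_plus[OF stable_is_matching[OF assms(1)] assms(3)]
      partner_in_plus[OF stable_is_matching[OF assms(2)] assms(3)]]
  by (auto simp: welfare_def)

lemma stable_eqI:
  assumes "M \<in> S" "N \<in> S" "\<And>a. a \<in> students I \<Longrightarrow> welfare M a = welfare N a"
  shows "M = N"
  using assms partner_eq_iff by (intro matching_eqI) (auto intro: stable_is_matching)

lemma matching_ge_iff:
  assumes "M \<in> S" "N \<in> S"
  shows "matching_ge I M N \<longleftrightarrow> (\<forall>a\<in>students I. welfare N a \<le> welfare M a)"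
proof -
  have "student_partner M a = student_partner N a \<or> (student_partner M a, student_partner N a) \<in> spref I a
    \<longleftrightarrow> welfare N a \<le> welfare M a" if a: "a \<in> students I" for a
    using partner_eq_iff[OF assms a] a
      util_less_iff[OF a partner_in_plus[OF stable_is_matching[OF assms(1)] a]
        partner_in_plus[OF stable_is_matching[OF assms(2)] a]]
    by (auto simp: welfare_def)
  then show ?thesis by (simp add: matching_ge_def)
qed

lemma stable_join_exists:
  assumes "M \<in> S" "N \<in> S"
  obtains K where "K \<in> S" "\<And>a. a \<in> students I \<Longrightarrow> welfare K a = max (welfare M a) (welfare N a)"
proof -
  have "stable_assignment (upper (student_partner M) (student_partner N))"
    by (intro stable_upper stable_assignment_partner assms)
  then obtain K where "K \<in> S" "\<And>a. a \<in> students I \<Longrightarrow> student_partner K a = upper (student_partner M) (student_partner N) a"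
    using stable_matching_of_assignment by blast
  then show ?thesis using that util_upper by (simp add: welfare_def)
qed

lemma stable_meet_exists:
  assumes "M \<in> S" "N \<in> S"
  obtains K where "K \<in> S" "\<And>a. a \<in> students I \<Longrightarrow> welfare K a = min (welfare M a) (welfare N a)"
proof -
  have "stable_assignment (lower (student_partner M) (student_partner N))"
    by (intro stable_lower stable_assignment_partner assms)
  then obtain K where "K \<in> S" "\<And>a. a \<in> students I \<Longrightarrow> student_partner K a = lower (student_partner M) (student_partner N) a"
    using stable_matching_of_assignment by blast
  then show ?thesis using that util_lower by (simp add: welfare_def)
qed

lemma finite_stable: "finite S"
proof (rule finite_subset)
  show "S \<subseteq> Pow (students_plus I \<times> schools_plus I)"
    by (auto simp: stable_matchings_def is_matching_def)
qed (use finite_students_plus finite_schools_plus in simp)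

abbreviation below :: "('a, 'b) matching \<Rightarrow> ('a, 'b) matching \<Rightarrow> bool" where
  "below M N \<equiv> (\<forall>a\<in>students I. welfare M a \<le> welfare N a)"

lemma below_antisym: "M \<in> S \<Longrightarrow> N \<in> S \<Longrightarrow> below M N \<Longrightarrow> below N M \<Longrightarrow> M = N"
  by (intro stable_eqI) (auto intro: antisym)

lemma stable_order_simps [simp]:
  "carrier (stable_order I) = S" "eq (stable_order I) = (=)"
  "M \<in> S \<Longrightarrow> N \<in> S \<Longrightarrow> le (stable_order I) M N \<longleftrightarrow> below M N"
  by (auto simp: stable_order_def matching_ge_iff)

lemma partial_order_stable: "partial_order (stable_order I)"
proof unfold_locales
  fix x y assume "x \<sqsubseteq>\<^bsub>stable_order I\<^esub> y" "y \<sqsubseteq>\<^bsub>stable_order I\<^esub> x"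
    "x \<in> carrier (stable_order I)" "y \<in> carrier (stable_order I)"
  then show "x .=\<^bsub>stable_order I\<^esub> y" using below_antisym[of x y] by simp
qed (auto intro: order_trans)

text \<open>The supremum is a \<open>SOME\<close> choice of a least upper bound, so it is identified
  through uniqueness in the partial order.\<close>

lemma sup_eqI:
  assumes "A \<subseteq> S" "K \<in> S" "\<And>M. M \<in> A \<Longrightarrow> below M K"
    "\<And>N. N \<in> S \<Longrightarrow> (\<And>M. M \<in> A \<Longrightarrow> below M N) \<Longrightarrow> below K N"
  shows "\<Squnion>\<^bsub>stable_order I\<^esub> A = K"
proof -
  have l: "least (stable_order I) K (Upper (stable_order I) A)"
    using assms by (intro least_UpperI) (auto simp: Upper_def subset_iff)
  then have "least (stable_order I) (\<Squnion>\<^bsub>stable_order I\<^esub> A) (Upper (stable_order I) A)"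
    unfolding sup_def by (rule someI)
  then show ?thesis using partial_order.least_unique[OF partial_order_stable _ l] by simp
qed

lemma inf_eqI:
  assumes "A \<subseteq> S" "K \<in> S" "\<And>M. M \<in> A \<Longrightarrow> below K M"
    "\<And>N. N \<in> S \<Longrightarrow> (\<And>M. M \<in> A \<Longrightarrow> below N M) \<Longrightarrow> below N K"
  shows "\<Sqinter>\<^bsub>stable_order I\<^esub> A = K"
proof -
  have l: "greatest (stable_order I) K (Lower (stable_order I) A)"
    using assms by (intro greatest_LowerI) (auto simp: Lower_def subset_iff)
  then have "greatest (stable_order I) (\<Sqinter>\<^bsub>stable_order I\<^esub> A) (Lower (stable_order I) A)"
    unfolding inf_def by (rule someI)
  then show ?thesis using partial_order.greatest_unique[OF partial_order_stable _ l] by simp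
qed

abbreviation Join :: "('a, 'b) matching \<Rightarrow> ('a, 'b) matching \<Rightarrow> ('a, 'b) matching" where
  "Join M N \<equiv> M \<squnion>\<^bsub>stable_order I\<^esub> N"

abbreviation Meet :: "('a, 'b) matching \<Rightarrow> ('a, 'b) matching \<Rightarrow> ('a, 'b) matching" where
  "Meet M N \<equiv> M \<sqinter>\<^bsub>stable_order I\<^esub> N"

lemma
  assumes "M \<in> S" "N \<in> S"
  shows Join_stable: "Join M N \<in> S"
    and welfare_Join: "a \<in> students I \<Longrightarrow> welfare (Join M N) a = max (welfare M a) (welfare N a)"
proof -
  obtain K where K: "K \<in> S" "\<And>a. a \<in> students I \<Longrightarrow> welfare K a = max (welfare M a) (welfare N a)"
    using stable_join_exists[OF assms] by blast
  have "Join M N = K"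
    unfolding join_def using assms K by (intro sup_eqI) auto
  then show "Join M N \<in> S" "a \<in> students I \<Longrightarrow> welfare (Join M N) a = max (welfare M a) (welfare N a)"
    using K by auto
qed

lemma
  assumes "M \<in> S" "N \<in> S"
  shows Meet_stable: "Meet M N \<in> S"
    and welfare_Meet: "a \<in> students I \<Longrightarrow> welfare (Meet M N) a = min (welfare M a) (welfare N a)"
proof -
  obtain K where K: "K \<in> S" "\<And>a. a \<in> students I \<Longrightarrow> welfare K a = min (welfare M a) (welfare N a)"
    using stable_meet_exists[OF assms] by blast
  have "Meet M N = K"
    unfolding meet_def using assms K by (intro inf_eqI) auto
  then show "Meet M N \<in> S" "a \<in> students I \<Longrightarrow> welfare (Meet M N) a = min (welfare M a) (welfare N a)"
    using K by auto
qed

text \<open>A finite non-empty family closed under binary joins contains its supremum. It is applied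
  to all stable matchings, to those past a given rotation, to \<open>F\<close>, and to the members
  of \<open>F\<close> past a given meta-rotation.\<close>

lemma sup_closed:
  assumes "F \<subseteq> S" "F \<noteq> {}" "\<And>M N. M \<in> F \<Longrightarrow> N \<in> F \<Longrightarrow> Join M N \<in> F"
  shows "\<Squnion>\<^bsub>stable_order I\<^esub> F \<in> F" and "M \<in> F \<Longrightarrow> below M (\<Squnion>\<^bsub>stable_order I\<^esub> F)"
proof -
  have "\<exists>K\<in>F. \<forall>M\<in>A. below M K" if "finite A" "A \<subseteq> F" for A
    using that
  proof (induction A)
    case empty
    then show ?case using assms(2) by auto
  next
    case (insert N A)
    then obtain K where K: "K \<in> F" "\<forall>M\<in>A. below M K" by auto
    have "below M (Join N K)" if "M \<in> insert N A" for M
      using that K insert.prems assms(1) welfare_Join[of N K] by (fastforce simp: le_max_iff_disj)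
    then show ?case using assms(3)[of N K] K(1) insert.prems by blast
  qed
  from this[of F] obtain K where K: "K \<in> F" "\<forall>M\<in>F. below M K"
    using finite_subset[OF assms(1) finite_stable] by auto
  have "\<Squnion>\<^bsub>stable_order I\<^esub> F = K" using K assms(1) by (intro sup_eqI) auto
  then show "\<Squnion>\<^bsub>stable_order I\<^esub> F \<in> F" "M \<in> F \<Longrightarrow> below M (\<Squnion>\<^bsub>stable_order I\<^esub> F)"
    using K by auto
qed

lemma
  assumes "M \<in> S"
  shows top_stable: "\<top>\<^bsub>stable_order I\<^esub> \<in> S" and below_top: "below M \<top>\<^bsub>stable_order I\<^esub>"
proof -
  let ?K = "\<Squnion>\<^bsub>stable_order I\<^esub> S"
  have K: "?K \<in> S" "\<And>N. N \<in> S \<Longrightarrow> below N ?K"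
    using sup_closed[of S] assms Join_stable by auto
  have g: "greatest (stable_order I) ?K S" using K by (simp add: greatest_def)
  then have "greatest (stable_order I) \<top>\<^bsub>stable_order I\<^esub> S" unfolding top_def stable_order_simps by (rule someI)
  then have "\<top>\<^bsub>stable_order I\<^esub> = ?K" using partial_order.greatest_unique[OF partial_order_stable _ g] by simp
  then show "\<top>\<^bsub>stable_order I\<^esub> \<in> S" "below M \<top>\<^bsub>stable_order I\<^esub>" using K assms by auto
qed

section \<open>Rotations\<close>

lemma immediate_predecessor_iff:
  "immediate_predecessor I M N \<longleftrightarrow> M \<in> S \<and> N \<in> S \<and> below M N \<and> M \<noteq> N \<and>
     (\<forall>K\<in>S. below M K \<longrightarrow> below K N \<longrightarrow> K = M \<or> K = N)"
  unfolding immediate_predecessor_def lless_def by (auto; metis)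

text \<open>A strictly monotone integer measure of the order; it yields extremal elements and drives
  inductions.\<close>

definition total :: "('a, 'b) matching \<Rightarrow> nat" where
  "total M = (\<Sum>a\<in>students I. welfare M a)"

lemma total_less:
  assumes "M \<in> S" "N \<in> S" "below M N" "M \<noteq> N"
  shows "total M < total N"
proof -
  have "\<exists>a\<in>students I. welfare M a < welfare N a"
    using assms below_antisym by (metis leI)
  then show ?thesis unfolding total_def using assms(3) finite_students
    by (intro sum_strict_mono_ex1) auto
qed

lemma exists_immediate_predecessor:
  assumes "M \<in> S" "N \<in> S" "below M N" "M \<noteq> N"
  obtains K where "immediate_predecessor I K N" "below M K"
proof -
  \<comment> \<open>A member of largest total leaves no room for a stable matching strictly between
    it and \<open>N\<close>.\<close>
  let ?A = "{K \<in> S. below M K \<and> below K N \<and> K \<noteq> N}"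
  have fin: "finite (total ` ?A)" "total ` ?A \<noteq> {}" using finite_stable assms by auto
  then obtain K where K: "K \<in> ?A" "total K = Max (total ` ?A)" using Max_in[OF fin] by fastforce
  have mx: "total L \<le> total K" if "L \<in> ?A" for L
    unfolding K(2) using fin(1) that by (intro Max_ge) auto
  have "immediate_predecessor I K N"
    unfolding immediate_predecessor_iff
  proof (intro conjI ballI impI)
    fix L assume L: "L \<in> S" "below K L" "below L N"
    show "L = K \<or> L = N"
    proof (rule ccontr)
      assume n: "\<not> ?thesis"
      have "below M L" using K(1) L(2) by (auto intro: order_trans)
      then have "L \<in> ?A" using L n by auto
      moreover have "total K < total L" using total_less[OF _ L(1,2)] K(1) n by auto
      ultimately show False using mx[of L] by simp
    qed
  qed (use K assms in auto)
  then show ?thesis using that K(1) by auto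
qed

definition movers :: "('a, 'b) matching \<Rightarrow> ('a, 'b) matching \<Rightarrow> 'a set" where
  "movers M N = {a \<in> students I. welfare M a \<noteq> welfare N a}"

text \<open>By \<open>rural_hospitals\<close> both matchings contain the same pairs with the outside
  option, so they differ in students' pairs only. A rotation thus records exactly its moved students
  with their old and new partners.\<close>

lemma stable_diff:
  assumes "M \<in> S" "N \<in> S"
  shows "M - N = (\<lambda>a. (Some a, student_partner M a)) ` movers M N"
proof -
  note m = stable_is_matching[OF assms(1)] stable_is_matching[OF assms(2)]
  have n: "(None, y) \<in> N" if "(None, y) \<in> M" for y
  proof -
    have "\<exists>b. y = Some b \<and> b \<in> schools I"
    proof (cases y)
      case None
      then show ?thesis using that m(1) unfolding is_matching_def by blast
    next
      case (Some b)
      then have "Some b \<in> schools_plus I" using that m(1) unfolding is_matching_def by blast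
      then show ?thesis using Some by simp
    qed
    then obtain b where b: "y = Some b" "b \<in> schools I" by blast
    have "card (assigned (student_partner M) b) = card (assigned (student_partner N) b)"
      by (intro rural_hospitals stable_assignment_partner assms b)
    then show ?thesis using that b assigned_quota(2)[OF m(1)] assigned_quota(2)[OF m(2)] by simp
  qed
  have a: "a \<in> students I" if "(Some a, y) \<in> M" for a y using that m(1) by (auto simp: is_matching_def)
  show ?thesis
  proof (intro subset_antisym subsetI)
    fix p assume p: "p \<in> M - N"
    obtain x y where xy: "p = (x, y)" by (cases p)
    then obtain a where xa: "x = Some a" using p n by (cases x) auto
    have s: "a \<in> students I" using p xy xa a by blast
    have "y = student_partner M a" "a \<in> movers M N"
      using p xy xa s pair_mem_iff[OF m(1) s] pair_mem_iff[OF m(2) s] partner_eq_iff[OF assms s]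
      by (auto simp: movers_def)
    then show "p \<in> (\<lambda>a. (Some a, student_partner M a)) ` movers M N"
      unfolding xy xa by blast
  next
    fix p assume "p \<in> (\<lambda>a. (Some a, student_partner M a)) ` movers M N"
    then show "p \<in> M - N"
      using pair_mem_iff m partner_eq_iff[OF assms] by (auto simp: movers_def)
  qed
qed

text \<open>
  \<open>passed \<rho> M\<close> turns out to be membership in \<open>R\<^sub>M\<close>: every student moved by \<open>\<rho>\<close> is in \<open>M\<close> at most
  as well off as after \<open>\<rho>\<close>.
\<close>

definition passed :: "('a, 'b) rotation \<Rightarrow> ('a, 'b) matching \<Rightarrow> bool" where
  "passed \<rho> M \<longleftrightarrow> (\<forall>a y. (Some a, y) \<in> snd \<rho> \<longrightarrow> welfare M a \<le> util a y)"

lemma passed_rotation: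
  assumes "N \<in> S" "N' \<in> S"
  shows "passed (rotation N N') M \<longleftrightarrow> (\<forall>a\<in>movers N N'. welfare M a \<le> welfare N' a)"
proof -
  have "movers N' N = movers N N'" by (auto simp: movers_def)
  then show ?thesis
    using stable_diff[OF assms(2,1)] by (auto simp: passed_def rotation_def welfare_def)
qed

lemma rotation_eqI:
  assumes "N \<in> S" "N' \<in> S" "K \<in> S" "K' \<in> S" "movers N N' = movers K K'"
    and "\<And>a. a \<in> movers K K' \<Longrightarrow> welfare N a = welfare K a"
    and "\<And>a. a \<in> movers K K' \<Longrightarrow> welfare N' a = welfare K' a"
  shows "rotation N N' = rotation K K'"
proof -
  have sym: "movers M L = movers L M" for M L by (auto simp: movers_def)
  have "student_partner N a = student_partner K a \<and> student_partner N' a = student_partner K' a"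
    if "a \<in> movers K K'" for a
    using that assms partner_eq_iff by (auto simp: movers_def)
  then show ?thesis
    unfolding rotation_def
    by (simp add: stable_diff assms(1-4) assms(5) sym[of N' N] sym[of K' K] cong: image_cong)
qed

lemma movers_predecessor:
  assumes "immediate_predecessor I N' N"
  shows "movers N N' \<noteq> {}" and "a \<in> movers N N' \<Longrightarrow> welfare N' a < welfare N a"
  using assms stable_eqI[of N N'] by (fastforce simp: movers_def immediate_predecessor_iff)+

text \<open>
  The matching \<open>(M \<squnion> N') \<sqinter> N\<close> lies between \<open>N'\<close> and \<open>N\<close>, hence equals one of them.
\<close>

lemma predecessor_dichotomy:
  assumes p: "immediate_predecessor I N' N" and M: "M \<in> S"
  shows "(\<forall>a\<in>movers N N'. welfare M a \<le> welfare N' a) \<or> (\<forall>a\<in>movers N N'. welfare N a \<le> welfare M a)"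
proof -
  have N: "N' \<in> S" "N \<in> S" "below N' N" using p by (auto simp: immediate_predecessor_iff)
  let ?K = "Meet (Join M N') N"
  have J: "Join M N' \<in> S" by (rule Join_stable[OF M N(1)])
  have w: "welfare ?K a = min (max (welfare M a) (welfare N' a)) (welfare N a)" if "a \<in> students I" for a
    using welfare_Meet[OF J N(2) that] welfare_Join[OF M N(1) that] by simp
  have "below N' ?K" "below ?K N" using w N(3) by auto
  moreover have "?K \<in> S" by (rule Meet_stable[OF J N(2)])
  ultimately consider "?K = N'" | "?K = N" using p by (auto simp: immediate_predecessor_iff)
  then show ?thesis
  proof cases
    case 1
    have "welfare M a \<le> welfare N' a" if "a \<in> movers N N'" for a
      using w[of a] movers_predecessor(2)[OF p that] that 1
      by (auto simp: movers_def min_def max_def split: if_splits)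
    then show ?thesis by blast
  next
    case 2
    have "welfare N a \<le> welfare M a" if "a \<in> movers N N'" for a
      using w[of a] movers_predecessor(2)[OF p that] that 2
      by (auto simp: movers_def min_def max_def split: if_splits)
    then show ?thesis by blast
  qed
qed

text \<open>A step that jumps across a rotation on all students moved by it is that rotation. A
  common mover decides which case of the dichotomy for the step from \<open>N\<close> to
  \<open>N'\<close> holds at \<open>K\<close> and at \<open>K'\<close>; this yields the reverse
  inequalities on all students moved by the step.\<close>

lemma rotation_eq_crossing:
  assumes K: "immediate_predecessor I K' K" and N: "immediate_predecessor I N' N"
    and up: "\<And>a. a \<in> movers K K' \<Longrightarrow> welfare K a \<le> welfare N a"
    and dn: "\<And>a. a \<in> movers K K' \<Longrightarrow> welfare N' a \<le> welfare K' a"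
  shows "rotation N N' = rotation K K'"
proof -
  have st: "K \<in> S" "K' \<in> S" "N \<in> S" "N' \<in> S"
    using K N by (auto simp: immediate_predecessor_iff)
  have lt: "welfare K' a < welfare K a" if "a \<in> movers K K'" for a
    by (rule movers_predecessor(2)[OF K that])
  have sub: "a \<in> movers N N'" if "a \<in> movers K K'" for a
    using up[OF that] dn[OF that] lt[OF that] that by (auto simp: movers_def)
  obtain a0 where a0: "a0 \<in> movers K K'" using movers_predecessor(1)[OF K] by blast
  have 1: "welfare N a \<le> welfare K a" if "a \<in> movers N N'" for a
    using predecessor_dichotomy[OF N st(1)] sub[OF a0] dn[OF a0] lt[OF a0] that by force
  have 2: "welfare K' a \<le> welfare N' a" if "a \<in> movers N N'" for a
    using predecessor_dichotomy[OF N st(2)] sub[OF a0] up[OF a0] lt[OF a0] that by force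
  have "movers N N' = movers K K'"
  proof (intro subset_antisym subsetI)
    fix a assume a: "a \<in> movers N N'"
    show "a \<in> movers K K'"
      using movers_predecessor(2)[OF N a] 1[OF a] 2[OF a] a by (auto simp: movers_def)
  qed (rule sub)
  then show ?thesis
    using 1 2 up dn st by (intro rotation_eqI) (auto intro: antisym)
qed

section \<open>Chains of eliminations and the rotations they contain\<close>

lemma exists_chain:
  assumes "M \<in> S" "N \<in> S" "below M N"
  shows "\<exists>Ms. Ms \<noteq> [] \<and> hd Ms = N \<and> last Ms = M \<and>
     (\<forall>i. Suc i < length Ms \<longrightarrow> immediate_predecessor I (Ms ! Suc i) (Ms ! i))"
  using assms(2,3)
proof (induction N rule: measure_induct_rule[of total])
  case (less N)
  show ?case
  proof (cases "M = N")
    case True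
    then show ?thesis by (intro exI[of _ "[N]"]) auto
  next
    case False
    obtain K where K: "immediate_predecessor I K N" "below M K"
      using exists_immediate_predecessor[OF assms(1) less.prems False] by blast
    have Ks: "K \<in> S" "total K < total N"
      using K(1) by (auto simp: immediate_predecessor_iff intro: total_less)
    then obtain Ms where Ms: "Ms \<noteq> []" "hd Ms = K" "last Ms = M"
      "\<forall>i. Suc i < length Ms \<longrightarrow> immediate_predecessor I (Ms ! Suc i) (Ms ! i)"
      using less.IH[OF Ks(2,1) K(2)] by blast
    have "immediate_predecessor I ((N # Ms) ! Suc i) ((N # Ms) ! i)" if "Suc i < length (N # Ms)" for i
      using that Ms K(1) by (cases i) (auto simp: hd_conv_nth)
    then show ?thesis using Ms(1,3) by (intro exI[of _ "N # Ms"]) auto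
  qed
qed

lemma chain_below:
  assumes "descending_chain I Ms M" "M \<in> S" "i < length Ms"
  shows "Ms ! i \<in> S" "below M (Ms ! i)"
proof -
  have l: "Ms ! (length Ms - 1) = M"
    and p: "\<And>i. Suc i < length Ms \<Longrightarrow> immediate_predecessor I (Ms ! Suc i) (Ms ! i)"
    using assms(1) by (auto simp: descending_chain_def last_conv_nth)
  have "Ms ! i \<in> S \<and> below M (Ms ! i)"
    using assms(3)
  \<comment> \<open>Induction backwards from the last entry, which is \<open>M\<close>
    itself.\<close>
  proof (induction "length Ms - 1 - i" arbitrary: i)
    case 0
    then have "i = length Ms - 1" by simp
    then show ?case using l assms(2) by simp
  next
    case (Suc k)
    then have i: "Suc i < length Ms" by simp
    then have "below M (Ms ! Suc i)" using Suc.hyps(1)[of "Suc i"] Suc.hyps(2) by simp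
    then show ?case using p[OF i] by (auto simp: immediate_predecessor_iff intro: order_trans)
  qed
  then show "Ms ! i \<in> S" "below M (Ms ! i)" by auto
qed

text \<open>The right-hand side does not mention the chain, which is why the set does not depend on
  it. The harder inclusion uses that a chain starts above every rotation and ends past the given
  one, so one of its steps must cross it.\<close>

lemma chain_rotations:
  assumes "descending_chain I Ms M" "M \<in> S"
  shows "{rotation (Ms ! i) (Ms ! Suc i) |i. Suc i < length Ms} = {\<rho> \<in> rotations I. passed \<rho> M}"
proof -
  let ?n = "length Ms"
  have ne: "Ms \<noteq> []" and h: "Ms ! 0 = \<top>\<^bsub>stable_order I\<^esub>" and l: "Ms ! (?n - 1) = M"
    and p: "\<And>i. Suc i < ?n \<Longrightarrow> immediate_predecessor I (Ms ! Suc i) (Ms ! i)"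
    using assms(1) by (auto simp: descending_chain_def hd_conv_nth last_conv_nth)
  have st: "Ms ! i \<in> S" if "i < ?n" for i
    by (rule chain_below(1)[OF assms that])
  show ?thesis
  proof (intro subset_antisym subsetI)
    fix \<rho> assume "\<rho> \<in> {rotation (Ms ! i) (Ms ! Suc i) |i. Suc i < ?n}"
    then obtain i where i: "\<rho> = rotation (Ms ! i) (Ms ! Suc i)" "Suc i < ?n" by blast
    have "below M (Ms ! Suc i)" by (rule chain_below(2)[OF assms i(2)])
    then have "passed \<rho> M"
      unfolding i(1) using passed_rotation[of "Ms ! i" "Ms ! Suc i"] st i(2) by (auto simp: movers_def)
    then show "\<rho> \<in> {\<rho> \<in> rotations I. passed \<rho> M}"
      using i p by (auto simp: rotations_def)
  next
    fix \<rho> assume "\<rho> \<in> {\<rho> \<in> rotations I. passed \<rho> M}"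
    then obtain K K' where \<rho>: "\<rho> = rotation K K'" "immediate_predecessor I K' K" "passed \<rho> M"
      by (auto simp: rotations_def)
    have K: "K \<in> S" "K' \<in> S" using \<rho>(2) by (auto simp: immediate_predecessor_iff)
    \<comment> \<open>\<open>Q i\<close> says that the entry at \<open>i\<close> is still above the
      rotation. By the dichotomy, the first entry where this fails is below the rotation, and the
      step leading to it crosses.\<close>
    define Q where "Q i \<longleftrightarrow> (\<forall>a\<in>movers K K'. welfare K a \<le> welfare (Ms ! i) a)" for i
    have Q0: "Q 0" unfolding Q_def h using below_top[OF K(1)] by (auto simp: movers_def)
    obtain a0 where a0: "a0 \<in> movers K K'" using movers_predecessor(1)[OF \<rho>(2)] by blast
    have Qn: "\<not> Q (?n - 1)"
      using a0 movers_predecessor(2)[OF \<rho>(2) a0] \<rho>(3) passed_rotation[OF K]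
      unfolding Q_def l \<rho>(1) by force
    define j where "j = (LEAST j. \<not> Q j)"
    have j: "\<not> Q j" "j \<le> ?n - 1" "\<And>i. i < j \<Longrightarrow> Q i"
      unfolding j_def using LeastI[of "\<lambda>j. \<not> Q j"] Least_le[of "\<lambda>j. \<not> Q j"] not_less_Least[of _ "\<lambda>j. \<not> Q j"] Qn
      by blast+
    obtain i where i: "j = Suc i" using j(1) Q0 by (cases j) auto
    have i': "Suc i < ?n" using j(2) i ne by (cases Ms) auto
    have "rotation (Ms ! i) (Ms ! Suc i) = rotation K K'"
    proof (rule rotation_eq_crossing[OF \<rho>(2) p[OF i']])
      show "welfare K a \<le> welfare (Ms ! i) a" if "a \<in> movers K K'" for a
        using j(3)[of i] i that by (auto simp: Q_def)
      show "welfare (Ms ! Suc i) a \<le> welfare K' a" if "a \<in> movers K K'" for a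
        using predecessor_dichotomy[OF \<rho>(2) st[OF i']] j(1) i that by (auto simp: Q_def)
    qed
    then show "\<rho> \<in> {rotation (Ms ! i) (Ms ! Suc i) |i. Suc i < ?n}" unfolding \<rho>(1) using i' by (auto intro!: exI[of _ i])
  qed
qed

lemma chain_exists:
  assumes "M \<in> S"
  obtains Ms where "descending_chain I Ms M"
  using exists_chain[OF assms top_stable[OF assms] below_top[OF assms]]
  unfolding descending_chain_def by blast

lemma rotation_set_eq:
  assumes "M \<in> S"
  shows "rotation_set I M = {\<rho> \<in> rotations I. passed \<rho> M}"
  unfolding rotation_set_def
proof (rule the_equality)
  obtain Ms where "descending_chain I Ms M" using chain_exists[OF assms] by blast
  then show "\<exists>Ms. descending_chain I Ms M \<and>
      {\<rho> \<in> rotations I. passed \<rho> M} = {rotation (Ms ! i) (Ms ! Suc i) |i. Suc i < length Ms}"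
    using chain_rotations[OF _ assms, symmetric] by (intro exI[of _ Ms] conjI)
qed (use chain_rotations[OF _ assms] in auto)

lemma rotations_cases:
  assumes "\<rho> \<in> rotations I"
  obtains N N' where "\<rho> = rotation N N'" "immediate_predecessor I N' N" "N \<in> S" "N' \<in> S"
  using assms by (auto simp: rotations_def immediate_predecessor_iff)

lemma finite_rotations: "finite (rotations I)"
proof (rule finite_subset)
  show "rotations I \<subseteq> (\<lambda>(M, N). rotation M N) ` (S \<times> S)"
    by (auto simp: rotations_def immediate_predecessor_iff)
qed (simp add: finite_stable)

lemma rotation_set_subset: "M \<in> S \<Longrightarrow> rotation_set I M \<subseteq> rotations I"
  by (auto simp: rotation_set_eq)

lemma rotation_set_antimono:
  assumes "M \<in> S" "N \<in> S" "below M N"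
  shows "rotation_set I N \<subseteq> rotation_set I M"
proof
  fix \<rho> assume "\<rho> \<in> rotation_set I N"
  then have \<rho>: "\<rho> \<in> rotations I" "passed \<rho> N" using assms by (auto simp: rotation_set_eq)
  obtain K K' where K: "\<rho> = rotation K K'" "immediate_predecessor I K' K" "K \<in> S" "K' \<in> S"
      by (rule rotations_cases[OF \<rho>(1)])
  have "passed \<rho> M"
    using \<rho>(2) assms(3) unfolding K(1) passed_rotation[OF K(3,4)] by (fastforce simp: movers_def)
  then show "\<rho> \<in> rotation_set I M" using \<rho> assms by (auto simp: rotation_set_eq)
qed

text \<open>If a rotation is passed at \<open>N'\<close> but not at \<open>N\<close>, then by the
  dichotomy \<open>N\<close> lies above it and \<open>N'\<close> below it, so the step crosses it
  and equals it.\<close>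

lemma rotation_set_predecessor:
  assumes p: "immediate_predecessor I N' N"
  shows "rotation_set I N' = insert (rotation N N') (rotation_set I N)"
proof -
  have N: "N' \<in> S" "N \<in> S" "below N' N" using p by (auto simp: immediate_predecessor_iff)
  have "\<rho> = rotation N N'" if \<rho>: "\<rho> \<in> rotations I" "passed \<rho> N'" "\<not> passed \<rho> N" for \<rho>
  proof -
    obtain K K' where K: "\<rho> = rotation K K'" "immediate_predecessor I K' K" "K \<in> S" "K' \<in> S"
      by (rule rotations_cases[OF \<rho>(1)])
    show ?thesis
      unfolding K(1)
    proof (rule rotation_eq_crossing[OF K(2) p, symmetric])
      show "welfare K a \<le> welfare N a" if "a \<in> movers K K'" for a
        using predecessor_dichotomy[OF K(2) N(2)] \<rho>(3) that
        unfolding K(1) passed_rotation[OF K(3,4)] by blast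
      show "welfare N' a \<le> welfare K' a" if "a \<in> movers K K'" for a
        using \<rho>(2) that unfolding K(1) passed_rotation[OF K(3,4)] by blast
    qed
  qed
  moreover have "rotation N N' \<in> rotations I" using p by (auto simp: rotations_def)
  moreover have "passed (rotation N N') N'" using passed_rotation[OF N(2,1)] by simp
  ultimately show ?thesis
    using rotation_set_antimono[OF N]
    unfolding rotation_set_eq[OF N(1)] rotation_set_eq[OF N(2)] by blast
qed

section \<open>Lattice operations and upper-closed sets of rotations\<close>

lemma rotation_set_Join:
  assumes "M \<in> S" "N \<in> S"
  shows "rotation_set I (Join M N) = rotation_set I M \<inter> rotation_set I N"
proof -
  have "passed \<rho> (Join M N) \<longleftrightarrow> passed \<rho> M \<and> passed \<rho> N" if \<rho>: "\<rho> \<in> rotations I" for \<rho>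
  proof -
    obtain K K' where K: "\<rho> = rotation K K'" "immediate_predecessor I K' K" "K \<in> S" "K' \<in> S"
      by (rule rotations_cases[OF \<rho>])
    show ?thesis unfolding K(1) passed_rotation[OF K(3,4)]
      using welfare_Join[OF assms] by (auto simp: movers_def)
  qed
  then show ?thesis using assms Join_stable by (auto simp: rotation_set_eq)
qed

text \<open>A minimum could be small at different movers because of different matchings. The
  dichotomy excludes this: if neither matching is past the rotation, both lie above it on all its
  movers, and so does the minimum.\<close>

lemma rotation_set_Meet:
  assumes "M \<in> S" "N \<in> S"
  shows "rotation_set I (Meet M N) = rotation_set I M \<union> rotation_set I N"
proof -
  have "passed \<rho> (Meet M N) \<longleftrightarrow> passed \<rho> M \<or> passed \<rho> N" if \<rho>: "\<rho> \<in> rotations I" for \<rho>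
  proof -
    obtain K K' where K: "\<rho> = rotation K K'" "immediate_predecessor I K' K" "K \<in> S" "K' \<in> S"
      by (rule rotations_cases[OF \<rho>])
    have w: "welfare (Meet M N) a = min (welfare M a) (welfare N a)" if "a \<in> movers K K'" for a
      using welfare_Meet[OF assms] that by (auto simp: movers_def)
    obtain a0 where a0: "a0 \<in> movers K K'" using movers_predecessor(1)[OF K(2)] by blast
    show ?thesis unfolding K(1) passed_rotation[OF K(3,4)]
      using w predecessor_dichotomy[OF K(2) assms(1)] predecessor_dichotomy[OF K(2) assms(2)]
        movers_predecessor(2)[OF K(2) a0] a0 by (fastforce simp: min_le_iff_disj)
  qed
  then show ?thesis using assms Meet_stable by (auto simp: rotation_set_eq)
qed

text \<open>Otherwise the join lies strictly above \<open>M\<close>, and some step down from it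
  stays above \<open>M\<close>. Its rotation belongs to both sets, so on a moved student both
  matchings, hence their join, are at most as well off as after the step, which is absurd.\<close>

lemma rotation_set_subset_imp_below:
  assumes "M \<in> S" "N \<in> S" "rotation_set I M \<subseteq> rotation_set I N"
  shows "below N M"
proof (rule ccontr)
  assume n: "\<not> below N M"
  let ?J = "Join M N"
  have J: "?J \<in> S" "below M ?J" "M \<noteq> ?J"
    using Join_stable[OF assms(1,2)] welfare_Join[OF assms(1,2)] n by (auto, metis max.cobounded2)
  obtain K where K: "immediate_predecessor I K ?J" "below M K"
    using exists_immediate_predecessor[OF assms(1) J] by blast
  have Ks: "K \<in> S" using K(1) by (simp add: immediate_predecessor_iff)
  have "rotation ?J K \<in> rotation_set I M"
    using rotation_set_predecessor[OF K(1)] rotation_set_antimono[OF assms(1) Ks K(2)] by blast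
  then have p: "passed (rotation ?J K) N" using assms by (auto simp: rotation_set_eq)
  obtain a where a: "a \<in> movers ?J K" using movers_predecessor(1)[OF K(1)] by blast
  have "a \<in> students I" using a by (simp add: movers_def)
  moreover have "welfare K a < welfare ?J a" by (rule movers_predecessor(2)[OF K(1) a])
  moreover have "welfare N a \<le> welfare K a" using p a unfolding passed_rotation[OF J(1) Ks] by blast
  ultimately show False using K(2) welfare_Join[OF assms(1,2)] by (force simp: max_def split: if_splits)
qed

lemma rotation_set_inj: "inj_on (rotation_set I) S"
  by (intro inj_onI below_antisym rotation_set_subset_imp_below) auto

text \<open>A chain to \<open>M\<close> exposes the rotation at one of its entries. A distinct
  larger rotation is already eliminated there, and rotation sets only grow further down.\<close>

lemma upper_closed_rotation_set:
  assumes M: "M \<in> S"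
  shows "upper_closed (rotations I) (rotation_ge I) (rotation_set I M)"
  unfolding upper_closed_def
proof (intro conjI ballI impI rotation_set_subset[OF M])
  fix \<rho> \<rho>' assume \<rho>: "\<rho> \<in> rotation_set I M" and \<rho>': "\<rho>' \<in> rotations I" "rotation_ge I \<rho>' \<rho>"
  obtain Ms where c: "descending_chain I Ms M" using chain_exists[OF M] by blast
  obtain i where i: "\<rho> = rotation (Ms ! i) (Ms ! Suc i)" "Suc i < length Ms"
    using \<rho> chain_rotations[OF c M] rotation_set_eq[OF M] by blast
  have p: "immediate_predecessor I (Ms ! Suc j) (Ms ! j)" if "Suc j < length Ms" for j
    using c that by (simp add: descending_chain_def)
  have b: "below M (Ms ! i)" using chain_below(2)[OF c M] i(2) by simp
  have s: "Ms ! i \<in> S" "exposed I \<rho> (Ms ! i)" using p[OF i(2)] i(1) by (auto simp: immediate_predecessor_iff exposed_def)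
  show "\<rho>' \<in> rotation_set I M"
  proof (cases "\<rho>' = \<rho>")
    case False
    then have "\<rho>' \<in> rotation_set I (Ms ! i)" using \<rho>'(2) s by (auto simp: rotation_ge_def)
    then show ?thesis using rotation_set_antimono[OF M s(1) b] by blast
  qed (use \<rho> in simp)
qed

text \<open>\<open>J\<close> is the join of all stable matchings past \<rho>. It serves as the
  matching of the principal up-set of \<rho>: its rotation set contains \<rho> and only rotations
  above it.\<close>

lemma exists_largest_passed:
  assumes "\<rho> \<in> rotations I"
  obtains J where "J \<in> S" "\<rho> \<in> rotation_set I J" "\<And>\<rho>'. \<rho>' \<in> rotation_set I J \<Longrightarrow> rotation_ge I \<rho>' \<rho>"
proof -
  let ?A = "{M \<in> S. \<rho> \<in> rotation_set I M}"
  let ?J = "\<Squnion>\<^bsub>stable_order I\<^esub> ?A"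
  obtain N N' where N: "\<rho> = rotation N N'" "immediate_predecessor I N' N" "N' \<in> S"
      by (rule rotations_cases[OF assms])
  have "N' \<in> ?A" using N rotation_set_predecessor[OF N(2)] by simp
  then have A: "?J \<in> ?A" and ub: "\<And>M. M \<in> ?A \<Longrightarrow> below M ?J"
    using sup_closed[of ?A] Join_stable rotation_set_Join by auto
  have "rotation_ge I \<rho>' \<rho>" if \<rho>': "\<rho>' \<in> rotation_set I ?J" for \<rho>'
    unfolding rotation_ge_def
  proof (cases "\<rho>' = \<rho>", simp, intro disjI2 ballI impI)
    fix M assume ne: "\<rho>' \<noteq> \<rho>" and M: "M \<in> S" "exposed I \<rho> M"
    then obtain M' where M': "immediate_predecessor I M' M" "\<rho> = rotation M M'" by (auto simp: exposed_def)
    \<comment> \<open>Eliminating \<rho> from \<open>M\<close> leads to a matching below the join,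
      so whatever the join has passed was eliminated at \<open>M\<close> already, except \<rho>
      itself.\<close>
    have "M' \<in> ?A" using M' rotation_set_predecessor[OF M'(1)] by (auto simp: immediate_predecessor_iff)
    then have "\<rho>' \<in> rotation_set I M'"
      using rotation_set_antimono[of M' ?J] ub[of M'] A \<rho>' by blast
    then show "\<rho>' \<in> rotation_set I M" using rotation_set_predecessor[OF M'(1)] M'(2) ne by auto
  qed
  then show ?thesis using that A by blast
qed

text \<open>An upper-closed set is a finite union of principal up-sets, and meets realise unions.
  The induction squeezes a rotation set between a finite \<open>V\<close> and \<open>U\<close>;
  taking \<open>V\<close> equal to \<open>U\<close> finishes.\<close>

lemma upper_closed_iff:
  assumes ne: "S \<noteq> {}"
  shows "upper_closed (rotations I) (rotation_ge I) U \<longleftrightarrow> U \<in> rotation_set I ` S"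
proof
  assume U: "upper_closed (rotations I) (rotation_ge I) U"
  then have sub: "U \<subseteq> rotations I" by (simp add: upper_closed_def)
  have "\<exists>M\<in>S. V \<subseteq> rotation_set I M \<and> rotation_set I M \<subseteq> U" if "finite V" "V \<subseteq> U" for V
    using that
  proof (induction V)
    case empty
    obtain M where M: "M \<in> S" using ne by blast
    let ?T = "\<top>\<^bsub>stable_order I\<^esub>"
    \<comment> \<open>A moved student is strictly better off before the rotation than after it, and
      the top element is at least as good as the matching before.\<close>
    have "\<not> passed \<rho> ?T" if "\<rho> \<in> rotations I" for \<rho>
    proof -
      obtain N N' where N: "\<rho> = rotation N N'" "immediate_predecessor I N' N" "N \<in> S" "N' \<in> S"
      by (rule rotations_cases[OF \<open>\<rho> \<in> rotations I\<close>])
      obtain a where a: "a \<in> movers N N'" using movers_predecessor(1)[OF N(2)] by blast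
      show ?thesis unfolding N(1) passed_rotation[OF N(3,4)]
        using a movers_predecessor(2)[OF N(2) a] below_top[OF N(3)] by (force simp: movers_def)
    qed
    then have "rotation_set I ?T = {}" using top_stable[OF M] by (auto simp: rotation_set_eq)
    then show ?case using top_stable[OF M] by auto
  next
    case (insert \<rho> V)
    then obtain M where M: "M \<in> S" "V \<subseteq> rotation_set I M" "rotation_set I M \<subseteq> U" by blast
    have \<rho>: "\<rho> \<in> U" "\<rho> \<in> rotations I" using insert.prems sub by auto
    obtain J where J: "J \<in> S" "\<rho> \<in> rotation_set I J" "\<And>\<rho>'. \<rho>' \<in> rotation_set I J \<Longrightarrow> rotation_ge I \<rho>' \<rho>"
      using exists_largest_passed[OF \<rho>(2)] by blast
    have "rotation_set I J \<subseteq> U"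
      using J rotation_set_subset[OF J(1)] U \<rho> by (auto simp: upper_closed_def)
    then show ?case
      using J M Meet_stable rotation_set_Meet[OF J(1) M(1)] by (intro bexI[of _ "Meet J M"]) auto
  qed
  from this[of U] show "U \<in> rotation_set I ` S"
    using finite_subset[OF sub finite_rotations] by blast
qed (auto intro: upper_closed_rotation_set)

lemma matching_of_rotation_set: "M \<in> S \<Longrightarrow> matching_of I (rotation_set I M) = M"
  unfolding matching_of_def by (rule inv_into_f_f[OF rotation_set_inj])

end

section \<open>Meta-rotations\<close>

locale stable_sublattice = school_market I for I :: "('a, 'b) school_instance" +
  fixes F :: "('a, 'b) matching set"
  assumes sublattice: "is_sublattice I F" and nonempty: "F \<noteq> {}"
begin

abbreviation P :: "('a, 'b) rotation set set" where
  "P \<equiv> proper_meta_rotations I F"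

abbreviation upset :: "('a, 'b) rotation set set \<Rightarrow> bool" where
  "upset \<equiv> upper_closed P (meta_ge I F)"

section \<open>Meta-rotations as blocks of the set of rotations\<close>

lemma F_stable: "M \<in> F \<Longrightarrow> M \<in> S"
  and F_Join: "M \<in> F \<Longrightarrow> N \<in> F \<Longrightarrow> Join M N \<in> F"
  and F_Meet: "M \<in> F \<Longrightarrow> N \<in> F \<Longrightarrow> Meet M N \<in> F"
  using sublattice by (auto simp: is_sublattice_def)

lemma equiv_meta: "equiv (rotations I) (meta_equiv I F)"
  by (rule equivI) (auto simp: meta_equiv_def refl_on_def sym_def trans_def)

lemma proper_cases:
  assumes "\<theta> \<in> P"
  obtains \<rho> where "\<rho> \<in> rotations I" "\<theta> = meta_equiv I F `` {\<rho>}" "\<rho> \<in> \<theta>"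
  using assms equiv_class_self[OF equiv_meta]
  by (auto simp: proper_meta_rotations_def quotient_def)

lemma proper_nonempty: "\<theta> \<in> P \<Longrightarrow> \<theta> \<noteq> {}"
  by (auto elim: proper_cases)

lemma proper_subset_rotations: "\<theta> \<in> P \<Longrightarrow> \<theta> \<subseteq> rotations I"
  by (auto elim!: proper_cases simp: meta_equiv_def)

text \<open>A class lies inside or outside the rotation set of a member of \<open>F\<close> as a
  whole, so any single element tests it. This justifies attaching arcs to one
  representative.\<close>

lemma proper_mem_iff:
  assumes "\<theta> \<in> P" "\<rho> \<in> \<theta>" "M \<in> F"
  shows "\<rho> \<in> rotation_set I M \<longleftrightarrow> \<theta> \<subseteq> rotation_set I M"
  using assms(1)
proof (rule proper_cases)
  fix \<sigma> assume "\<sigma> \<in> rotations I" "\<theta> = meta_equiv I F `` {\<sigma>}" "\<sigma> \<in> \<theta>"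
  then show ?thesis using assms(2,3) by (auto simp: meta_equiv_def)
qed

lemma proper_eqI:
  assumes "\<theta> \<in> P" "\<theta>' \<in> P" "\<rho> \<in> \<theta>" "\<rho> \<in> \<theta>'"
  shows "\<theta> = \<theta>'"
  using assms quotient_disj[OF equiv_meta, of \<theta> \<theta>'] by (auto simp: proper_meta_rotations_def)

text \<open>A class whose rotations occur for every member of \<open>F\<close> is all of
  \<open>theta_0\<close>, and one whose rotations occur for none is all of \<open>theta_z\<close>;
  proper classes exclude both.\<close>

lemma proper_not_trivial:
  assumes "\<theta> \<in> P"
  obtains M N where "M \<in> F" "N \<in> F" "\<theta> \<subseteq> rotation_set I M" "\<theta> \<inter> rotation_set I N = {}"
proof -
  obtain \<rho> where \<rho>: "\<rho> \<in> rotations I" "\<theta> = meta_equiv I F `` {\<rho>}" "\<rho> \<in> \<theta>"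
    using assms by (rule proper_cases)
  have "\<theta> \<noteq> theta_0 I F" "\<theta> \<noteq> theta_z I F" using assms by (auto simp: proper_meta_rotations_def)
  have "\<exists>N\<in>F. \<rho> \<notin> rotation_set I N"
  proof (rule ccontr)
    assume "\<not> ?thesis"
    then have "\<theta> = theta_0 I F" unfolding \<rho>(2) using \<rho>(1) by (auto simp: meta_equiv_def theta_0_def)
    then show False using \<open>\<theta> \<noteq> theta_0 I F\<close> by simp
  qed
  moreover have "\<exists>M\<in>F. \<rho> \<in> rotation_set I M"
  proof (rule ccontr)
    assume "\<not> ?thesis"
    then have "\<theta> = theta_z I F" unfolding \<rho>(2) using \<rho>(1) by (auto simp: meta_equiv_def theta_z_def)
    then show False using \<open>\<theta> \<noteq> theta_z I F\<close> by simp
  qed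
  ultimately obtain M N where "M \<in> F" "N \<in> F" "\<rho> \<in> rotation_set I M" "\<rho> \<notin> rotation_set I N" by blast
  then show ?thesis using that[of M N] proper_mem_iff[OF assms] \<rho>(3) by blast
qed

lemma class_proper:
  assumes "\<rho> \<in> rotations I" "\<rho> \<notin> theta_0 I F" "\<rho> \<notin> theta_z I F"
  shows "meta_equiv I F `` {\<rho>} \<in> P" "\<rho> \<in> meta_equiv I F `` {\<rho>}"
  using assms equiv_class_self[OF equiv_meta assms(1)]
  by (auto simp: proper_meta_rotations_def quotient_def)

lemma proper_disjoint_trivial:
  assumes "\<theta> \<in> P"
  shows "\<theta> \<inter> theta_0 I F = {}" "\<theta> \<inter> theta_z I F = {}"
proof -
  obtain M N where "M \<in> F" "N \<in> F" "\<theta> \<subseteq> rotation_set I M" "\<theta> \<inter> rotation_set I N = {}"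
    using assms by (rule proper_not_trivial)
  then show "\<theta> \<inter> theta_0 I F = {}" "\<theta> \<inter> theta_z I F = {}"
    by (auto simp: theta_0_def theta_z_def)
qed

lemma rotations_partition: "rotations I = theta_0 I F \<union> theta_z I F \<union> \<Union>P"
proof (intro subset_antisym subsetI)
  fix \<rho> assume "\<rho> \<in> rotations I"
  then show "\<rho> \<in> theta_0 I F \<union> theta_z I F \<union> \<Union>P" using class_proper[of \<rho>] by blast
next
  fix \<rho> assume "\<rho> \<in> theta_0 I F \<union> theta_z I F \<union> \<Union>P"
  then show "\<rho> \<in> rotations I" using proper_subset_rotations by (auto simp: theta_0_def theta_z_def)
qed

lemma finite_proper: "finite P"
  by (rule finite_subset[of _ "Pow (rotations I)"]) (use proper_subset_rotations finite_rotations in auto)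

text \<open>Within \<open>F\<close>, \<open>theta_0\<close> is always present,
  \<open>theta_z\<close> always absent, and every other class is all or nothing. Hence
  \<open>meta_set\<close> determines the matching.\<close>

lemma rotation_set_decompose:
  assumes M: "M \<in> F"
  shows "rotation_set I M = theta_0 I F \<union> \<Union>(meta_set I F M)"
proof (intro subset_antisym subsetI)
  fix \<rho> assume \<rho>: "\<rho> \<in> rotation_set I M"
  then have r: "\<rho> \<in> rotations I" using rotation_set_subset[OF F_stable[OF M]] by blast
  show "\<rho> \<in> theta_0 I F \<union> \<Union>(meta_set I F M)"
  proof (cases "\<rho> \<in> theta_0 I F")
    case False
    moreover have "\<rho> \<notin> theta_z I F" using \<rho> M by (auto simp: theta_z_def)
    ultimately have c: "meta_equiv I F `` {\<rho>} \<in> P" "\<rho> \<in> meta_equiv I F `` {\<rho>}"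
      using class_proper r by auto
    then have "meta_equiv I F `` {\<rho>} \<in> meta_set I F M"
      using proper_mem_iff[OF c M] \<rho> by (simp add: meta_set_def)
    then show ?thesis using c by blast
  qed simp
qed (use M in \<open>auto simp: theta_0_def meta_set_def\<close>)

lemma meta_set_subset: "meta_set I F M \<subseteq> P"
  by (auto simp: meta_set_def)

section \<open>Members of the sublattice and up-sets of proper meta-rotations\<close>

lemma meta_set_inj: "inj_on (meta_set I F) F"
proof (rule inj_onI)
  fix M N assume "M \<in> F" "N \<in> F" "meta_set I F M = meta_set I F N"
  then show "M = N"
    using rotation_set_decompose rotation_set_inj F_stable by (metis inj_onD)
qed

lemma meta_matching_meta_set: "M \<in> F \<Longrightarrow> meta_matching I F (meta_set I F M) = M"
  unfolding meta_matching_def by (rule inv_into_f_f[OF meta_set_inj])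

text \<open>Inclusion in a union of two rotation sets implies inclusion in one of them, because one
  rotation of the class decides for the whole class.\<close>

lemma meta_set_Meet:
  assumes "M \<in> F" "N \<in> F"
  shows "meta_set I F (Meet M N) = meta_set I F M \<union> meta_set I F N"
proof -
  have "\<theta> \<subseteq> rotation_set I (Meet M N) \<longleftrightarrow> \<theta> \<subseteq> rotation_set I M \<or> \<theta> \<subseteq> rotation_set I N" if \<theta>: "\<theta> \<in> P" for \<theta>
  proof -
    obtain \<rho> where \<rho>: "\<rho> \<in> \<theta>" using proper_nonempty[OF \<theta>] by blast
    show ?thesis
      using rotation_set_Meet[OF F_stable[OF assms(1)] F_stable[OF assms(2)]]
        proper_mem_iff[OF \<theta> \<rho>] assms F_Meet[OF assms] by blast
  qed
  then show ?thesis by (auto simp: meta_set_def)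
qed

lemma M_0F_in_F: "M_0F I F \<in> F" and meta_set_M_0F: "meta_set I F (M_0F I F) = {}"
proof -
  have st: "F \<subseteq> S" using F_stable by blast
  show F0: "M_0F I F \<in> F" unfolding M_0F_def by (rule sup_closed(1)[OF st nonempty F_Join])
  have "\<theta> \<notin> meta_set I F (M_0F I F)" if \<theta>: "\<theta> \<in> P" for \<theta>
  proof -
    obtain M N where MN: "M \<in> F" "N \<in> F" "\<theta> \<subseteq> rotation_set I M" "\<theta> \<inter> rotation_set I N = {}"
      using \<theta> by (rule proper_not_trivial)
    have "below N (M_0F I F)" unfolding M_0F_def by (rule sup_closed(2)[OF st nonempty F_Join MN(2)])
    then have "rotation_set I (M_0F I F) \<subseteq> rotation_set I N"
      by (rule rotation_set_antimono[OF F_stable[OF MN(2)] F_stable[OF F0]])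
    then show ?thesis using MN(4) proper_nonempty[OF \<theta>] by (auto simp: meta_set_def)
  qed
  then show "meta_set I F (M_0F I F) = {}" using meta_set_subset by blast
qed

lemma meta_ge_antisym:
  assumes "\<theta> \<in> P" "\<theta>' \<in> P" "meta_ge I F \<theta> \<theta>'" "meta_ge I F \<theta>' \<theta>"
  shows "\<theta> = \<theta>'"
proof -
  obtain \<rho> where \<rho>: "\<rho> \<in> rotations I" "\<theta> = meta_equiv I F `` {\<rho>}" "\<rho> \<in> \<theta>"
    using assms(1) by (rule proper_cases)
  obtain \<rho>' where \<rho>': "\<rho>' \<in> rotations I" "\<theta>' = meta_equiv I F `` {\<rho>'}" "\<rho>' \<in> \<theta>'"
    using assms(2) by (rule proper_cases)
  have "(\<rho>, \<rho>') \<in> meta_equiv I F"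
    using \<rho>(1) \<rho>'(1) proper_mem_iff[OF assms(1) \<rho>(3)] proper_mem_iff[OF assms(2) \<rho>'(3)] assms(3,4)
    by (auto simp: meta_equiv_def meta_ge_def)
  then show ?thesis unfolding \<rho>(2) \<rho>'(2) by (rule equiv_class_eq[OF equiv_meta])
qed

lemma upset_meta_set: "M \<in> F \<Longrightarrow> upset (meta_set I F M)"
  by (auto simp: upper_closed_def meta_set_def meta_ge_def)

text \<open>The analogue of \<open>exists_largest_passed\<close> relative to \<open>F\<close>: the
  join of the members containing \<theta> has the smallest rotation set among them, which consists
  of what \<theta> forces.\<close>

lemma exists_up_matching:
  assumes \<theta>: "\<theta> \<in> P"
  obtains J where "J \<in> F" "meta_set I F J = {\<theta>' \<in> P. meta_ge I F \<theta>' \<theta>}"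
proof -
  let ?A = "{M \<in> F. \<theta> \<subseteq> rotation_set I M}"
  let ?J = "\<Squnion>\<^bsub>stable_order I\<^esub> ?A"
  have A: "?A \<subseteq> S" using F_stable by blast
  obtain M0 where "M0 \<in> F" "\<theta> \<subseteq> rotation_set I M0" using \<theta> by (rule proper_not_trivial)
  then have A2: "?A \<noteq> {}" by blast
  have A3: "Join M N \<in> ?A" if "M \<in> ?A" "N \<in> ?A" for M N
    using that F_Join rotation_set_Join[OF F_stable F_stable] by auto
  note A = A A2 A3
  have J: "?J \<in> F" "\<theta> \<subseteq> rotation_set I ?J" using sup_closed(1)[OF A] by auto
  have "rotation_set I ?J \<subseteq> rotation_set I M" if "M \<in> ?A" for M
    by (rule rotation_set_antimono[OF _ _ sup_closed(2)[OF A that]]) (use that J F_stable in auto)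
  then have "meta_set I F ?J = {\<theta>' \<in> P. meta_ge I F \<theta>' \<theta>}"
    using J by (auto simp: meta_set_def meta_ge_def)
  then show ?thesis using that J(1) by blast
qed

text \<open>The same squeezing induction as for rotations, with \<open>M_0F I F\<close> for the
  empty set and the matchings of \<open>exists_up_matching\<close> for principal up-sets.\<close>

lemma upset_iff: "upset \<Theta> \<longleftrightarrow> \<Theta> \<in> meta_set I F ` F"
proof
  assume U: "upset \<Theta>"
  have "\<exists>M\<in>F. V \<subseteq> meta_set I F M \<and> meta_set I F M \<subseteq> \<Theta>" if "finite V" "V \<subseteq> \<Theta>" for V
    using that
  proof (induction V)
    case empty
    then show ?case using M_0F_in_F meta_set_M_0F by auto
  next
    case (insert \<theta> V)
    then obtain M where M: "M \<in> F" "V \<subseteq> meta_set I F M" "meta_set I F M \<subseteq> \<Theta>" by blast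
    have \<theta>: "\<theta> \<in> \<Theta>" "\<theta> \<in> P" using insert.prems U by (auto simp: upper_closed_def)
    obtain J where J: "J \<in> F" "meta_set I F J = {\<theta>' \<in> P. meta_ge I F \<theta>' \<theta>}"
      using exists_up_matching[OF \<theta>(2)] .
    have "\<theta> \<in> meta_set I F J" using J(2) \<theta>(2) by (simp add: meta_ge_def)
    moreover have "meta_set I F J \<subseteq> \<Theta>" using J(2) U \<theta> by (auto simp: upper_closed_def)
    ultimately show ?case
      using M meta_set_Meet[OF J(1) M(1)] F_Meet[OF J(1) M(1)] by (intro bexI[of _ "Meet J M"]) auto
  qed
  from this[of \<Theta>] show "\<Theta> \<in> meta_set I F ` F"
    using U finite_subset[OF _ finite_proper, of \<Theta>] by (auto simp: upper_closed_def)
qed (auto intro: upset_meta_set)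

lemma meta_matching_upset:
  assumes "upset \<Theta>"
  shows "meta_matching I F \<Theta> \<in> F" "meta_set I F (meta_matching I F \<Theta>) = \<Theta>"
  using assms meta_matching_meta_set by (auto simp: upset_iff)

lemma upset_up: "upset {\<theta>' \<in> P. meta_ge I F \<theta>' \<theta>}"
  by (auto simp: upper_closed_def meta_ge_def)

lemma upset_down:
  assumes "\<theta> \<in> P"
  shows "upset {\<theta>' \<in> P. meta_gt I F \<theta>' \<theta>}"
  unfolding upper_closed_def
proof (intro conjI ballI impI)
  fix x y assume x: "x \<in> {\<theta>' \<in> P. meta_gt I F \<theta>' \<theta>}" and y: "y \<in> P" "meta_ge I F y x"
  have "meta_ge I F y \<theta>" using x y by (auto simp: meta_gt_def meta_ge_def)
  moreover have "y \<noteq> \<theta>" using x y(2) meta_ge_antisym[of x \<theta>] assms by (auto simp: meta_gt_def)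
  ultimately show "y \<in> {\<theta>' \<in> P. meta_gt I F \<theta>' \<theta>}" using y(1) by (simp add: meta_gt_def)
qed auto

lemma
  assumes "\<theta> \<in> P"
  shows M_up_in_F: "M_up I F \<theta> \<in> F" and meta_set_M_up: "meta_set I F (M_up I F \<theta>) = {\<theta>' \<in> P. meta_ge I F \<theta>' \<theta>}"
    and M_down_in_F: "M_down I F \<theta> \<in> F" and meta_set_M_down: "meta_set I F (M_down I F \<theta>) = {\<theta>' \<in> P. meta_gt I F \<theta>' \<theta>}"
  unfolding M_up_def M_down_def
  using meta_matching_upset[OF upset_up] meta_matching_upset[OF upset_down[OF assms]] by auto

end

section \<open>Functions on the up-sets of a finite poset\<close>

text \<open>The order-theoretic core of necessity: \<open>h\<close> plays the objective on up-sets,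
  \<open>K\<close> the capacity joining two elements. The premises of
  \<open>second_difference\<close> admit only incomparable pairs, since the larger of two comparable
  elements would have to lie in the base set already.\<close>

locale upset_function =
  fixes P :: "'c set" and ge :: "'c \<Rightarrow> 'c \<Rightarrow> bool" and h :: "'c set \<Rightarrow> real" and K :: "'c \<Rightarrow> 'c \<Rightarrow> real"
  assumes finite_P: "finite P"
    and refl: "ge x x"
    and trans: "ge x y \<Longrightarrow> ge y z \<Longrightarrow> ge x z"
    and antisym: "x \<in> P \<Longrightarrow> y \<in> P \<Longrightarrow> ge x y \<Longrightarrow> ge y x \<Longrightarrow> x = y"
    and second_difference: "upper_closed P ge \<Psi> \<Longrightarrow> upper_closed P ge (insert x \<Psi>) \<Longrightarrow>
      upper_closed P ge (insert y \<Psi>) \<Longrightarrow> x \<notin> \<Psi> \<Longrightarrow> y \<notin> \<Psi> \<Longrightarrow> x \<noteq> y \<Longrightarrow>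
      h (insert x \<Psi>) + h (insert y \<Psi>) - h \<Psi> - h (insert x (insert y \<Psi>)) = K x y"
    and K_nonneg: "0 \<le> K x y"
begin

section \<open>First and second differences\<close>

definition Up :: "'c \<Rightarrow> 'c set" where "Up x = {y \<in> P. ge y x}"

definition Down :: "'c \<Rightarrow> 'c set" where "Down x = {y \<in> P. ge y x \<and> y \<noteq> x}"

definition d1 :: "'c \<Rightarrow> real" where "d1 x = h (Up x) - h (Down x)"

definition d2 :: "'c \<Rightarrow> 'c \<Rightarrow> real" where
  "d2 x y = h (Up x \<union> Down y) + h (Down x \<union> Up y) - h (Down x \<union> Down y) - h (Up x \<union> Up y)"

lemma d2_sym: "d2 x y = d2 y x"
  by (simp add: d2_def Un_commute)

lemma Up_insert: "x \<in> P \<Longrightarrow> Up x = insert x (Down x)"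
  using refl by (auto simp: Up_def Down_def)

lemma upper_closed_Up: "upper_closed P ge (Up x)"
  using trans by (auto simp: upper_closed_def Up_def)

lemma upper_closed_Down: "x \<in> P \<Longrightarrow> upper_closed P ge (Down x)"
  using trans antisym by (auto simp: upper_closed_def Down_def)

lemma upper_closed_Un: "upper_closed P ge A \<Longrightarrow> upper_closed P ge B \<Longrightarrow> upper_closed P ge (A \<union> B)"
  by (auto simp: upper_closed_def)

text \<open>The principal up-set of the larger element is contained in the strict up-set of the
  smaller one, so the four terms cancel in pairs.\<close>

lemma d2_above:
  assumes "x \<in> P" "y \<in> P" "x \<noteq> y" "ge y x"
  shows "d2 x y = 0"
proof -
  have "Up y \<subseteq> Down x"
    using assms trans antisym by (auto simp: Up_def Down_def)
  moreover have "Down y \<subseteq> Up y" "Down x \<subseteq> Up x" by (auto simp: Up_def Down_def)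
  ultimately have "Up x \<union> Down y = Up x" "Down x \<union> Up y = Down x" "Down x \<union> Down y = Down x"
    "Up x \<union> Up y = Up x" by blast+
  then show ?thesis by (simp add: d2_def)
qed

text \<open>The union of the two strict up-sets is the smallest base to which both elements can be
  added, in either order.\<close>

lemma d2_incomparable:
  assumes "x \<in> P" "y \<in> P" "x \<noteq> y" "\<not> ge y x" "\<not> ge x y"
  shows "d2 x y = K x y"
proof -
  let ?\<Psi> = "Down x \<union> Down y"
  have *: "Up x \<union> Down y = insert x ?\<Psi>" "Down x \<union> Up y = insert y ?\<Psi>"
    "Up x \<union> Up y = insert x (insert y ?\<Psi>)"
    using Up_insert assms(1,2) by auto
  have "h (insert x ?\<Psi>) + h (insert y ?\<Psi>) - h ?\<Psi> - h (insert x (insert y ?\<Psi>)) = K x y"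
  proof (rule second_difference)
    show "upper_closed P ge ?\<Psi>"
      by (intro upper_closed_Un upper_closed_Down assms)
    show "upper_closed P ge (insert x ?\<Psi>)"
      unfolding *(1)[symmetric] by (intro upper_closed_Un upper_closed_Down upper_closed_Up assms)
    show "upper_closed P ge (insert y ?\<Psi>)"
      unfolding *(2)[symmetric] by (intro upper_closed_Un upper_closed_Down upper_closed_Up assms)
  qed (use assms in \<open>auto simp: Down_def\<close>)
  then show ?thesis by (simp add: d2_def *)
qed

lemma d2_nonneg:
  assumes "x \<in> P" "y \<in> P" "x \<noteq> y"
  shows "0 \<le> d2 x y"
proof -
  consider "ge y x" | "ge x y" | "\<not> ge y x" "\<not> ge x y" by blast
  then show ?thesis
  proof cases
    case 1
    then show ?thesis using d2_above[OF assms] by simp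
  next
    case 2
    then show ?thesis using d2_above[OF assms(2,1)] assms(3) d2_sym[of x y] by simp
  next
    case 3
    then show ?thesis using d2_incomparable[OF assms] K_nonneg by simp
  qed
qed

text \<open>Going strictly down enlarges the principal up-set, so one of largest size belongs to a
  minimal element. Minimal elements are those that can be removed from an up-set without losing
  upper closure.\<close>

lemma exists_lowest:
  assumes "A \<subseteq> P" "A \<noteq> {}"
  obtains m where "m \<in> A" "\<And>x. x \<in> A \<Longrightarrow> ge m x \<Longrightarrow> x = m"
proof -
  have fin: "finite ((\<lambda>x. card (Up x)) ` A)" "(\<lambda>x. card (Up x)) ` A \<noteq> {}"
    using assms finite_P finite_subset by auto
  obtain m where m: "m \<in> A" "card (Up m) = Max ((\<lambda>x. card (Up x)) ` A)"
    using Max_in[OF fin] by fastforce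
  have "x = m" if x: "x \<in> A" "ge m x" for x
  proof (rule ccontr)
    assume "x \<noteq> m"
    then have "x \<notin> Up m" using antisym[of x m] x m(1) assms(1) by (auto simp: Up_def)
    moreover have "x \<in> Up x" using x(1) assms(1) refl by (auto simp: Up_def)
    moreover have "Up m \<subseteq> Up x" using x(2) trans by (auto simp: Up_def)
    moreover have "finite (Up x)" using finite_P by (simp add: Up_def)
    ultimately have "card (Up m) < card (Up x)" by (intro psubset_card_mono) auto
    moreover have "card (Up x) \<le> card (Up m)" unfolding m(2) using fin(1) x(1) by (intro Max_ge) auto
    ultimately show False by simp
  qed
  then show ?thesis using that m(1) by blast
qed

text \<open>At its smallest base \<open>Down x\<close>, the increment of \<open>x\<close> is
  \<open>d1 x\<close>, and every further element \<open>y\<close> of the base lowers it by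
  \<open>d2 x y\<close>. By \<open>d2_above\<close> the elements of \<open>Down x\<close> add zeros,
  so the sum may run over the whole base.\<close>

lemma insert_difference:
  assumes "x \<in> P" "x \<notin> \<Psi>" "upper_closed P ge \<Psi>" "upper_closed P ge (insert x \<Psi>)"
  shows "h (insert x \<Psi>) - h \<Psi> = d1 x - (\<Sum>y\<in>\<Psi>. d2 x y)"
  using assms(2-4)
proof (induction "card (\<Psi> - Down x)" arbitrary: \<Psi>)
  case 0
  have sub: "\<Psi> \<subseteq> P" using 0 by (auto simp: upper_closed_def)
  have "finite \<Psi>" using sub finite_P by (rule finite_subset)
  then have "\<Psi> \<subseteq> Down x" using 0(1) by auto
  moreover have "Down x \<subseteq> \<Psi>" using 0(4) by (auto simp: upper_closed_def Down_def)
  ultimately have eq: "\<Psi> = Down x" by blast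
  have "(\<Sum>y\<in>\<Psi>. d2 x y) = 0"
    unfolding eq using d2_above assms(1) by (intro sum.neutral) (auto simp: Down_def)
  then show ?case using Up_insert[OF assms(1)] by (simp add: eq d1_def)
next
  case (Suc n)
  have sub: "\<Psi> \<subseteq> P" using Suc.prems by (auto simp: upper_closed_def)
  have fin: "finite \<Psi>" using sub finite_P by (rule finite_subset)
  have down: "Down x \<subseteq> \<Psi>" using Suc.prems(3) by (auto simp: upper_closed_def Down_def)
  have "\<Psi> - Down x \<subseteq> P" using sub by blast
  moreover have "\<Psi> - Down x \<noteq> {}" using Suc.hyps(2) by (metis card.empty nat.distinct(1))
  ultimately obtain m where m: "m \<in> \<Psi> - Down x" "\<And>y. y \<in> \<Psi> - Down x \<Longrightarrow> ge m y \<Longrightarrow> y = m"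
    using exists_lowest by blast
  let ?\<Phi> = "\<Psi> - {m}"
  have mP: "m \<in> P" and mx: "m \<noteq> x" using m(1) sub Suc.prems(1) by auto
  have nxm: "\<not> ge x m" using Suc.prems(1,2) m(1) assms(1) by (auto simp: upper_closed_def)
  have nmx: "\<not> ge m x" using m(1) mP mx by (auto simp: Down_def)
  \<comment> \<open>\<open>m\<close> is lowest only outside \<open>Down x\<close>, but that
    suffices: an element of the set below \<open>m\<close> would lie in \<open>Down x\<close> and so
    put \<open>m\<close> above \<open>x\<close>.\<close>
  have up: "upper_closed P ge ?\<Phi>"
    unfolding upper_closed_def
  proof (intro conjI ballI impI)
    fix y z assume y: "y \<in> ?\<Phi>" and z: "z \<in> P" "ge z y"
    have "z \<in> \<Psi>" using y z Suc.prems(2) by (auto simp: upper_closed_def)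
    moreover have "z \<noteq> m"
    proof
      assume "z = m"
      then have "y \<in> Down x" using m(2)[of y] y z(2) by auto
      then have "ge m x" using z(2) \<open>z = m\<close> trans by (auto simp: Down_def)
      then show False using nmx by simp
    qed
    ultimately show "z \<in> ?\<Phi>" by simp
  qed (use sub in auto)
  have "insert x ?\<Phi> = ?\<Phi> \<union> Up x" using Up_insert[OF assms(1)] down m(1) by auto
  then have upx: "upper_closed P ge (insert x ?\<Phi>)" using upper_closed_Un[OF up upper_closed_Up] by simp
  have ins: "insert m ?\<Phi> = \<Psi>" using m(1) by auto
  have "card (?\<Phi> - Down x) = n"
  proof -
    have "?\<Phi> - Down x = (\<Psi> - Down x) - {m}" by auto
    then show ?thesis using Suc.hyps(2) m(1) fin by simp
  qed
  then have IH: "h (insert x ?\<Phi>) - h ?\<Phi> = d1 x - (\<Sum>y\<in>?\<Phi>. d2 x y)"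
    using Suc.hyps(1)[of ?\<Phi>] Suc.prems(1) up upx by auto
  \<comment> \<open>The increments of \<open>x\<close> with and without \<open>m\<close> differ by a
    second difference, and \<open>m\<close> and \<open>x\<close> are incomparable.\<close>
  have "h (insert x ?\<Phi>) + h \<Psi> - h ?\<Phi> - h (insert x \<Psi>) = K x m"
    using second_difference[OF up upx, of m] ins Suc.prems mx by auto
  also have "K x m = d2 x m" using d2_incomparable[OF assms(1) mP] mx nxm nmx by auto
  moreover have "(\<Sum>y\<in>\<Psi>. d2 x y) = d2 x m + (\<Sum>y\<in>?\<Phi>. d2 x y)"
    using m(1) fin by (intro sum.remove) auto
  ultimately show ?case using IH by linarith
qed

text \<open>Adding a lowest element \<open>m\<close> last deducts \<open>d2 m y\<close> once for
  each earlier \<open>y\<close>, whereas the sum over ordered pairs contains \<open>m\<close> in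
  both coordinates. By \<open>d2_sym\<close> the two contributions agree, whence the factor
  1/2.\<close>

lemma expansion:
  assumes "upper_closed P ge \<Psi>"
  shows "h \<Psi> = h {} + (\<Sum>x\<in>\<Psi>. d1 x) -
    1/2 * (\<Sum>(x, y)\<in>{(x, y). x \<in> \<Psi> \<and> y \<in> \<Psi> \<and> x \<noteq> y}. d2 x y)"
  using assms
proof (induction "card \<Psi>" arbitrary: \<Psi>)
  case 0
  have "finite \<Psi>" using 0 finite_P finite_subset by (auto simp: upper_closed_def)
  then have "\<Psi> = {}" using 0 by simp
  then show ?case by simp
next
  case (Suc n)
  have sub: "\<Psi> \<subseteq> P" using Suc.prems by (auto simp: upper_closed_def)
  have fin: "finite \<Psi>" using sub finite_P by (rule finite_subset)
  have "\<Psi> \<noteq> {}" using Suc.hyps(2) by auto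
  then obtain m where m: "m \<in> \<Psi>" "\<And>y. y \<in> \<Psi> \<Longrightarrow> ge m y \<Longrightarrow> y = m"
    using exists_lowest[OF sub] by blast
  let ?\<Phi> = "\<Psi> - {m}"
  have ins: "insert m ?\<Phi> = \<Psi>" using m(1) by auto
  have up: "upper_closed P ge ?\<Phi>"
    using Suc.prems m by (auto simp: upper_closed_def)
  have IH: "h ?\<Phi> = h {} + (\<Sum>x\<in>?\<Phi>. d1 x) -
    1/2 * (\<Sum>(x, y)\<in>{(x, y). x \<in> ?\<Phi> \<and> y \<in> ?\<Phi> \<and> x \<noteq> y}. d2 x y)"
    using Suc.hyps m(1) fin up by (intro Suc.hyps(1)) auto
  have diff: "h \<Psi> - h ?\<Phi> = d1 m - (\<Sum>y\<in>?\<Phi>. d2 m y)"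
    using insert_difference[of m ?\<Phi>] up Suc.prems m(1) sub ins by auto
  have s1: "(\<Sum>x\<in>\<Psi>. d1 x) = d1 m + (\<Sum>x\<in>?\<Phi>. d1 x)"
    using m(1) fin by (intro sum.remove) auto
  let ?Q = "{(x, y). x \<in> ?\<Phi> \<and> y \<in> ?\<Phi> \<and> x \<noteq> y}"
  have split: "{(x, y). x \<in> \<Psi> \<and> y \<in> \<Psi> \<and> x \<noteq> y} = ?Q \<union> (Pair m ` ?\<Phi> \<union> (\<lambda>y. (y, m)) ` ?\<Phi>)"
    using m(1) by auto
  have finQ: "finite ?Q" by (rule finite_subset[of _ "\<Psi> \<times> \<Psi>"]) (use fin in auto)
  have "(\<Sum>(x, y)\<in>{(x, y). x \<in> \<Psi> \<and> y \<in> \<Psi> \<and> x \<noteq> y}. d2 x y)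
      = (\<Sum>(x, y)\<in>?Q. d2 x y) + ((\<Sum>(x, y)\<in>Pair m ` ?\<Phi>. d2 x y) + (\<Sum>(x, y)\<in>(\<lambda>y. (y, m)) ` ?\<Phi>. d2 x y))"
    unfolding split
    by (subst sum.union_disjoint, use fin finQ in \<open>auto\<close>)
      (subst sum.union_disjoint, use fin in \<open>auto\<close>)
  also have "(\<Sum>(x, y)\<in>Pair m ` ?\<Phi>. d2 x y) = (\<Sum>y\<in>?\<Phi>. d2 m y)"
    by (subst sum.reindex) (auto simp: inj_on_def)
  also have "(\<Sum>(x, y)\<in>(\<lambda>y. (y, m)) ` ?\<Phi>. d2 x y) = (\<Sum>y\<in>?\<Phi>. d2 m y)"
    by (subst sum.reindex) (auto simp: inj_on_def d2_sym[of m])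
  finally show ?case using IH diff s1 by (simp add: algebra_simps)
qed

end

section \<open>Cut functions\<close>

text \<open>Real-valued and summed over all arcs with an indicator, so that values at different
  vertex sets can be subtracted arc by arc.\<close>

definition cut_weight :: "('v, 'e) pre_digraph \<Rightarrow> ('e \<Rightarrow> ereal) \<Rightarrow> 'v set \<Rightarrow> real" where
  "cut_weight D cap X =
     (\<Sum>e\<in>arcs D. real_of_ereal (cap e) * of_bool (tail D e \<in> X \<and> head D e \<notin> X))"

lemma cut_capacity_finite_iff:
  assumes "finite (arcs D)" "\<forall>e\<in>arcs D. 0 \<le> cap e"
  shows "cut_capacity D cap X < \<infinity> \<longleftrightarrow>
    (\<forall>e\<in>arcs D. tail D e \<in> X \<longrightarrow> head D e \<notin> X \<longrightarrow> cap e < \<infinity>)"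
  unfolding cut_capacity_def ereal_infty_less(1) sum_Pinfty using assms(1) by auto

lemma cut_capacity_eq_weight:
  assumes fin: "finite (arcs D)" and nn: "\<forall>e\<in>arcs D. 0 \<le> cap e"
    and X: "cut_capacity D cap X < \<infinity>"
  shows "cut_capacity D cap X = ereal (cut_weight D cap X)"
proof -
  let ?C = "{e \<in> arcs D. tail D e \<in> X \<and> head D e \<notin> X}"
  have "cap e = ereal (real_of_ereal (cap e))" if "e \<in> ?C" for e
    using X nn that unfolding cut_capacity_finite_iff[OF fin nn]
    by (cases "cap e") auto
  then have "cut_capacity D cap X = (\<Sum>e\<in>?C. ereal (real_of_ereal (cap e)))"
    unfolding cut_capacity_def by (intro sum.cong) auto
  also have "\<dots> = ereal (\<Sum>e\<in>?C. real_of_ereal (cap e))" by (rule sum_ereal)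
  also have "(\<Sum>e\<in>?C. real_of_ereal (cap e)) = cut_weight D cap X"
    unfolding cut_weight_def using fin by (intro sum.mono_neutral_cong_left) auto
  finally show ?thesis .
qed

text \<open>An arc leaving the union or the intersection leaves one of the two sets.\<close>

lemma cut_capacity_Un_Int_finite:
  assumes "finite (arcs D)" "\<forall>e\<in>arcs D. 0 \<le> cap e"
    and "cut_capacity D cap X < \<infinity>" "cut_capacity D cap Y < \<infinity>"
  shows "cut_capacity D cap (X \<union> Y) < \<infinity>" "cut_capacity D cap (X \<inter> Y) < \<infinity>"
  using assms(3,4) unfolding cut_capacity_finite_iff[OF assms(1,2)] by auto

text \<open>
  The right-hand side does not depend on \<open>X\<close>. An infinite capacity counts as \<open>0\<close> in
  \<open>cut_weight\<close>, which is harmless on cuts of finite capacity.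
\<close>

lemma cut_weight_second_difference:
  assumes "A \<inter> B = {}" "A \<inter> X = {}" "B \<inter> X = {}"
  shows "cut_weight D cap (X \<union> A) + cut_weight D cap (X \<union> B) - cut_weight D cap X
      - cut_weight D cap (X \<union> A \<union> B)
    = (\<Sum>e\<in>arcs D. real_of_ereal (cap e) *
        (of_bool (tail D e \<in> A \<and> head D e \<in> B) + of_bool (tail D e \<in> B \<and> head D e \<in> A)))"
  unfolding cut_weight_def sum.distrib[symmetric] sum_subtractf[symmetric]
  using assms by (intro sum.cong refl) (auto simp: of_bool_def)

text \<open>Representability asks for arcs that are naturals, while the cut digraph has structured
  arcs; an injection of the finite arc set preserves all cut capacities.\<close>

lemma witness_rename:
  assumes w: "witness_digraph I F f D cap"
  shows "min_cut_representable I F f"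
proof -
  interpret fin_digraph D using w by (simp add: witness_digraph_def)
  obtain g :: "'c \<Rightarrow> nat" where g: "inj_on g (arcs D)"
    using finite_imp_inj_to_nat_seg[OF finite_arcs] by blast
  let ?i = "inv_into (arcs D) g"
  let ?D = "\<lparr>verts = verts D, arcs = g ` arcs D, tail = tail D \<circ> ?i, head = head D \<circ> ?i\<rparr>"
  have inv: "?i (g e) = e" if "e \<in> arcs D" for e using g that by simp
  have cc: "cut_capacity ?D (cap \<circ> ?i) X = cut_capacity D cap X" for X
  proof -
    have "{e \<in> arcs ?D. tail ?D e \<in> X \<and> head ?D e \<notin> X} = g ` {e \<in> arcs D. tail D e \<in> X \<and> head D e \<notin> X}"
      using inv by auto
    moreover have "inj_on g {e \<in> arcs D. tail D e \<in> X \<and> head D e \<notin> X}"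
      using g by (rule inj_on_subset) auto
    ultimately show ?thesis
      unfolding cut_capacity_def using inv by (simp add: sum.reindex)
  qed
  have "fin_digraph ?D"
    by unfold_locales (use inv in auto)
  then have "witness_digraph I F f ?D (cap \<circ> ?i)"
    using w inv unfolding witness_digraph_def cc by auto
  then show ?thesis unfolding min_cut_representable_def by blast
qed

section \<open>Necessity\<close>

context school_market
begin

lemma witness_cut_finite_iff:
  assumes w: "witness_digraph I F f D cap" and M: "M \<in> S"
  shows "cut_capacity D cap ({Source} \<union> Rot ` rotation_set I M) < \<infinity> \<longleftrightarrow> M \<in> F"
  using w rotation_set_subset[OF M] upper_closed_rotation_set[OF M] matching_of_rotation_set[OF M]
  unfolding witness_digraph_def by metis

lemma witness_imp_sublattice:
  assumes w: "witness_digraph I F f D cap" and F: "F \<subseteq> S"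
  shows "is_sublattice I F"
proof -
  interpret fin_digraph D using w by (simp add: witness_digraph_def)
  have nn: "\<forall>e\<in>arcs D. 0 \<le> cap e" using w by (simp add: witness_digraph_def)
  have "Join M N \<in> F \<and> Meet M N \<in> F" if MN: "M \<in> F" "N \<in> F" for M N
  proof -
    have st: "M \<in> S" "N \<in> S" using MN F by auto
    have "cut_capacity D cap ({Source} \<union> Rot ` rotation_set I M) < \<infinity>"
      "cut_capacity D cap ({Source} \<union> Rot ` rotation_set I N) < \<infinity>"
      using witness_cut_finite_iff[OF w] st MN by auto
    note * = cut_capacity_Un_Int_finite[OF finite_arcs nn this]
    have "({Source} \<union> Rot ` rotation_set I M) \<union> ({Source} \<union> Rot ` rotation_set I N)
        = {Source} \<union> Rot ` rotation_set I (Meet M N)"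
      "({Source} \<union> Rot ` rotation_set I M) \<inter> ({Source} \<union> Rot ` rotation_set I N)
        = {Source} \<union> Rot ` rotation_set I (Join M N)"
      using rotation_set_Meet[OF st] rotation_set_Join[OF st] by auto
    then show ?thesis
      using * witness_cut_finite_iff[OF w Meet_stable[OF st]] witness_cut_finite_iff[OF w Join_stable[OF st]]
      by simp
  qed
  then show ?thesis using F by (simp add: is_sublattice_def)
qed

end

section \<open>Differentials read off from a witness digraph\<close>

context stable_sublattice
begin

text \<open>The objective transported to up-sets; only its values at up-sets are meaningful, since
  \<open>meta_matching\<close> is arbitrary elsewhere.\<close>

definition on_upset :: "(('a, 'b) matching \<Rightarrow> real) \<Rightarrow> ('a, 'b) rotation set set \<Rightarrow> real" where
  "on_upset f \<Theta> = f (meta_matching I F \<Theta>)"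

lemma on_upset_meta_set: "M \<in> F \<Longrightarrow> on_upset f (meta_set I F M) = f M"
  by (simp add: on_upset_def meta_matching_meta_set)

lemma diff1_on_upset:
  "diff1 I F f \<theta> = on_upset f {\<theta>' \<in> P. meta_ge I F \<theta>' \<theta>} - on_upset f {\<theta>' \<in> P. meta_gt I F \<theta>' \<theta>}"
  by (simp add: diff1_def on_upset_def M_up_def M_down_def)

text \<open>Meets of matchings are unions of their sets of meta-rotations, which brings the second
  differential into the form of \<open>d2\<close>.\<close>

lemma diff2_on_upset:
  assumes "\<theta> \<in> P" "\<theta>' \<in> P"
  defines "U \<equiv> \<lambda>\<theta>. {\<theta>' \<in> P. meta_ge I F \<theta>' \<theta>}" and "D \<equiv> \<lambda>\<theta>. {\<theta>' \<in> P. meta_gt I F \<theta>' \<theta>}"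
  shows "diff2 I F f \<theta> \<theta>' = on_upset f (U \<theta> \<union> D \<theta>') + on_upset f (D \<theta> \<union> U \<theta>')
    - on_upset f (D \<theta> \<union> D \<theta>') - on_upset f (U \<theta> \<union> U \<theta>')"
proof -
  have *: "f (Meet M N) = on_upset f (meta_set I F M \<union> meta_set I F N)" if "M \<in> F" "N \<in> F" for M N
    using on_upset_meta_set[OF F_Meet[OF that]] meta_set_Meet[OF that] by simp
  note in_F = M_up_in_F[OF assms(1)] M_up_in_F[OF assms(2)] M_down_in_F[OF assms(1)] M_down_in_F[OF assms(2)]
  show ?thesis
    unfolding diff2_def U_def D_def
    by (simp add: * in_F meta_set_M_up meta_set_M_down assms(1,2))
qed

lemma witness_imp_differentials:
  assumes w: "witness_digraph I F f D cap"
  shows "\<And>\<theta> \<theta>'. \<theta> \<in> P \<Longrightarrow> \<theta>' \<in> P \<Longrightarrow> \<theta> \<noteq> \<theta>' \<Longrightarrow> 0 \<le> diff2 I F f \<theta> \<theta>'"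
    and "\<And>M. M \<in> F \<Longrightarrow> f M = f (M_0F I F) + (\<Sum>\<theta>\<in>meta_set I F M. diff1 I F f \<theta>)
      - 1/2 * (\<Sum>(\<theta>, \<theta>')\<in>{(\<theta>, \<theta>'). \<theta> \<in> meta_set I F M \<and> \<theta>' \<in> meta_set I F M \<and> \<theta> \<noteq> \<theta>'}.
                 diff2 I F f \<theta> \<theta>')"
proof -
  interpret fin_digraph D using w by (simp add: witness_digraph_def)
  have nn: "\<forall>e\<in>arcs D. 0 \<le> cap e" using w by (simp add: witness_digraph_def)
  obtain C where C: "\<And>R. R \<subseteq> rotations I \<Longrightarrow> cut_capacity D cap ({Source} \<union> Rot ` R) < \<infinity> \<Longrightarrow>
      cut_capacity D cap ({Source} \<union> Rot ` R) = ereal (f (matching_of I R) + C)"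
    using w unfolding witness_digraph_def by blast
  \<comment> \<open>The source side of the cut for an up-set. \<open>theta_0\<close> belongs to
    every such cut, as it lies in all rotation sets of members of \<open>F\<close>.\<close>
  define X where "X \<Theta> = {Source} \<union> Rot ` (theta_0 I F \<union> \<Union>\<Theta>)" for \<Theta>
  define K where "K \<theta> \<theta>' = (\<Sum>e\<in>arcs D. real_of_ereal (cap e) *
        (of_bool (tail D e \<in> Rot ` \<theta> \<and> head D e \<in> Rot ` \<theta>') +
         of_bool (tail D e \<in> Rot ` \<theta>' \<and> head D e \<in> Rot ` \<theta>)))" for \<theta> \<theta>'
  \<comment> \<open>The constant \<open>C\<close> enters a second difference twice with each sign
    and cancels.\<close>
  have cut: "cut_weight D cap (X \<Theta>) = on_upset f \<Theta> + C" if \<Theta>: "upset \<Theta>" for \<Theta>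
  proof -
    obtain M where M: "M \<in> F" "\<Theta> = meta_set I F M" using \<Theta> by (auto simp: upset_iff)
    have X: "X \<Theta> = {Source} \<union> Rot ` rotation_set I M"
      by (simp add: X_def M(2) rotation_set_decompose[OF M(1)])
    have fin: "cut_capacity D cap (X \<Theta>) < \<infinity>"
      unfolding X using witness_cut_finite_iff[OF w F_stable[OF M(1)]] M(1) by simp
    have "ereal (cut_weight D cap (X \<Theta>)) = ereal (f (matching_of I (rotation_set I M)) + C)"
      using cut_capacity_eq_weight[OF finite_arcs nn fin] fin
        C[OF rotation_set_subset[OF F_stable[OF M(1)]]] unfolding X by simp
    then show ?thesis
      using matching_of_rotation_set[OF F_stable[OF M(1)]] on_upset_meta_set[OF M(1)] M(2) by simp
  qed
  interpret A: upset_function P "meta_ge I F" "on_upset f" K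
  proof
    show "finite P" by (rule finite_proper)
    show "meta_ge I F x x" for x by (simp add: meta_ge_def)
    show "meta_ge I F x y \<Longrightarrow> meta_ge I F y z \<Longrightarrow> meta_ge I F x z" for x y z by (simp add: meta_ge_def)
    show "x \<in> P \<Longrightarrow> y \<in> P \<Longrightarrow> meta_ge I F x y \<Longrightarrow> meta_ge I F y x \<Longrightarrow> x = y" for x y
      by (rule meta_ge_antisym)
    show "0 \<le> K x y" for x y
      unfolding K_def using nn by (intro sum_nonneg mult_nonneg_nonneg) (auto simp: real_of_ereal_pos)
    fix \<Psi> x y assume up: "upset \<Psi>" "upset (insert x \<Psi>)" "upset (insert y \<Psi>)"
      and xy: "x \<notin> \<Psi>" "y \<notin> \<Psi>" "x \<noteq> y"
    have P: "x \<in> P" "y \<in> P" "\<Psi> \<subseteq> P" using up by (auto simp: upper_closed_def)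
    \<comment> \<open>A union of two up-sets, so the fourth cut of the second difference is finite
      as well.\<close>
    have upxy: "upset (insert x (insert y \<Psi>))"
      using up by (auto simp: upper_closed_def)
    have d: "x \<inter> y = {}" "x \<inter> z = {}" "y \<inter> z = {}" if "z \<in> \<Psi>" for z
      using proper_eqI[of x y] proper_eqI[of x z] proper_eqI[of y z] P xy that by blast+
    have dxy: "x \<inter> y = {}" using proper_eqI[of x y] P xy by blast
    have "Rot ` x \<inter> Rot ` y = {}" "Rot ` x \<inter> X \<Psi> = {}" "Rot ` y \<inter> X \<Psi> = {}"
      using dxy d proper_disjoint_trivial(1)[OF P(1)] proper_disjoint_trivial(1)[OF P(2)]
      unfolding X_def by blast+
    note sd = cut_weight_second_difference[OF this, of D cap]
    have "X \<Psi> \<union> Rot ` x = X (insert x \<Psi>)" "X \<Psi> \<union> Rot ` y = X (insert y \<Psi>)"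
      "X \<Psi> \<union> Rot ` x \<union> Rot ` y = X (insert x (insert y \<Psi>))"
      by (auto simp: X_def)
    then show "on_upset f (insert x \<Psi>) + on_upset f (insert y \<Psi>) - on_upset f \<Psi>
        - on_upset f (insert x (insert y \<Psi>)) = K x y"
      using sd cut[OF up(1)] cut[OF up(2)] cut[OF up(3)] cut[OF upxy] unfolding K_def[symmetric] by simp
  qed
  have Up: "A.Up \<theta> = {\<theta>' \<in> P. meta_ge I F \<theta>' \<theta>}" "A.Down \<theta> = {\<theta>' \<in> P. meta_gt I F \<theta>' \<theta>}" for \<theta>
    by (auto simp: A.Up_def A.Down_def meta_gt_def)
  have d1: "A.d1 \<theta> = diff1 I F f \<theta>" for \<theta>
    by (simp add: A.d1_def diff1_on_upset Up)
  have d2: "A.d2 \<theta> \<theta>' = diff2 I F f \<theta> \<theta>'" if "\<theta> \<in> P" "\<theta>' \<in> P" for \<theta> \<theta>'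
    by (simp add: A.d2_def diff2_on_upset[OF that] Up)
  show "0 \<le> diff2 I F f \<theta> \<theta>'" if "\<theta> \<in> P" "\<theta>' \<in> P" "\<theta> \<noteq> \<theta>'" for \<theta> \<theta>'
    using A.d2_nonneg[OF that] d2 that by simp
  show "f M = f (M_0F I F) + (\<Sum>\<theta>\<in>meta_set I F M. diff1 I F f \<theta>)
      - 1/2 * (\<Sum>(\<theta>, \<theta>')\<in>{(\<theta>, \<theta>'). \<theta> \<in> meta_set I F M \<and> \<theta>' \<in> meta_set I F M \<and> \<theta> \<noteq> \<theta>'}.
                 diff2 I F f \<theta> \<theta>')" if M: "M \<in> F" for M
  proof -
    have "(\<Sum>(\<theta>, \<theta>')\<in>{(\<theta>, \<theta>'). \<theta> \<in> meta_set I F M \<and> \<theta>' \<in> meta_set I F M \<and> \<theta> \<noteq> \<theta>'}. A.d2 \<theta> \<theta>')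
      = (\<Sum>(\<theta>, \<theta>')\<in>{(\<theta>, \<theta>'). \<theta> \<in> meta_set I F M \<and> \<theta>' \<in> meta_set I F M \<and> \<theta> \<noteq> \<theta>'}. diff2 I F f \<theta> \<theta>')"
      using d2 meta_set_subset by (intro sum.cong refl) auto
    then show ?thesis
      using A.expansion[OF upset_meta_set[OF M]] on_upset_meta_set[OF M]
        on_upset_meta_set[OF M_0F_in_F] meta_set_M_0F d1 by simp
  qed
qed

end

section \<open>Sufficiency\<close>

lemma cut_digraph_simps [simp]:
  "verts (cut_digraph I F rep) = {Source, Sink} \<union> Rot ` rotations I"
  "tail (cut_digraph I F rep) = cut_arc_tail rep"
  "head (cut_digraph I F rep) = cut_arc_head rep"
  "Within \<rho> \<rho>' \<in> arcs (cut_digraph I F rep) \<longleftrightarrow>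
     (\<exists>\<theta>\<in>meta_rotations I F. \<rho> \<in> \<theta> \<and> \<rho>' \<in> \<theta> \<and> \<rho> \<noteq> \<rho>')"
  "Precede \<theta> \<theta>' \<in> arcs (cut_digraph I F rep) \<longleftrightarrow>
     \<theta> \<in> proper_meta_rotations I F \<and> \<theta>' \<in> proper_meta_rotations I F \<and> meta_gt I F \<theta>' \<theta>"
  "Interact \<theta> \<theta>' \<in> arcs (cut_digraph I F rep) \<longleftrightarrow>
     \<theta> \<in> proper_meta_rotations I F \<and> \<theta>' \<in> proper_meta_rotations I F \<and> \<theta> \<noteq> \<theta>'"
  "SourceTrivial \<theta> \<in> arcs (cut_digraph I F rep) \<longleftrightarrow> \<theta> = theta_0 I F \<and> \<theta> \<noteq> {}"
  "TrivialSink \<theta> \<in> arcs (cut_digraph I F rep) \<longleftrightarrow> \<theta> = theta_z I F \<and> \<theta> \<noteq> {}"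
  "SourceProper \<theta> \<in> arcs (cut_digraph I F rep) \<longleftrightarrow> \<theta> \<in> proper_meta_rotations I F"
  "ProperSink \<theta> \<in> arcs (cut_digraph I F rep) \<longleftrightarrow> \<theta> \<in> proper_meta_rotations I F"
  by (simp_all add: cut_digraph_def image_iff del: split_paired_Ex) auto

section \<open>Finite cuts of the cut digraph and their values\<close>

context stable_sublattice
begin

context
  fixes rep :: "('a, 'b) rotation set \<Rightarrow> ('a, 'b) rotation"
  assumes rep: "\<And>\<theta>. \<theta> \<in> meta_rotations I F \<Longrightarrow> \<theta> \<noteq> {} \<Longrightarrow> rep \<theta> \<in> \<theta>"
begin

abbreviation cutD :: "(('a, 'b) rotation vertex, ('a, 'b) rotation cut_arc) pre_digraph" where
  "cutD \<equiv> cut_digraph I F rep"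

lemma rep_proper: "\<theta> \<in> P \<Longrightarrow> rep \<theta> \<in> \<theta>"
  using rep proper_nonempty by (simp add: meta_rotations_def)

lemma meta_subset_rotations: "\<theta> \<in> meta_rotations I F \<Longrightarrow> \<theta> \<subseteq> rotations I"
  using proper_subset_rotations by (auto simp: meta_rotations_def theta_0_def theta_z_def)

lemma finite_cut_arcs: "finite (arcs cutD)"
proof -
  let ?A = "{Within x y |x y. x \<in> rotations I \<and> y \<in> rotations I} \<union>
    {Precede x y |x y. x \<in> P \<and> y \<in> P} \<union> {Interact x y |x y. x \<in> P \<and> y \<in> P} \<union>
    {SourceTrivial (theta_0 I F), TrivialSink (theta_z I F)} \<union> SourceProper ` P \<union> ProperSink ` P"
  have "arcs cutD \<subseteq> ?A"
  proof
    fix e assume "e \<in> arcs cutD"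
    then show "e \<in> ?A"
    proof (cases e)
      case (Within \<rho> \<rho>')
      then show ?thesis using \<open>e \<in> arcs cutD\<close> meta_subset_rotations by (simp del: split_paired_Ex) blast
    qed simp_all
  qed
  moreover have "finite ?A"
    by (intro finite_UnI finite_image_set2 finite_imageI) (simp_all add: finite_rotations finite_proper)
  ultimately show ?thesis by (rule finite_subset)
qed

lemma fin_digraph_cut: "fin_digraph cutD"
proof -
  have "rep \<theta> \<in> rotations I" if "\<theta> \<in> meta_rotations I F" "\<theta> \<noteq> {}" for \<theta>
    using rep[OF that] meta_subset_rotations[OF that(1)] by blast
  then have r: "rep \<theta> \<in> rotations I" if "\<theta> \<in> P \<or> \<theta> = theta_0 I F \<or> \<theta> = theta_z I F" "\<theta> \<noteq> {}" for \<theta>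
    using that by (auto simp: meta_rotations_def)
  have m: "\<rho> \<in> rotations I" if "\<rho> \<in> \<theta>" "\<theta> \<in> meta_rotations I F" for \<rho> \<theta>
    using meta_subset_rotations[OF that(2)] that(1) by blast
  show ?thesis
  proof
    show "tail cutD e \<in> verts cutD" "head cutD e \<in> verts cutD" if e: "e \<in> arcs cutD" for e
    proof -
      have "tail cutD e \<in> verts cutD \<and> head cutD e \<in> verts cutD"
      proof (cases e)
        case (Within \<rho> \<rho>')
        then show ?thesis using e m by simp blast
      qed (use e r proper_nonempty in simp_all)
      then show "tail cutD e \<in> verts cutD" "head cutD e \<in> verts cutD" by auto
    qed
    show "finite (verts cutD)" by (simp add: finite_rotations)
    show "finite (arcs cutD)" by (rule finite_cut_arcs)
  qed
qed

context
  fixes f :: "('a, 'b) matching \<Rightarrow> real" and \<gamma> :: real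
  assumes diff2_nonneg: "\<And>\<theta> \<theta>'. \<theta> \<in> P \<Longrightarrow> \<theta>' \<in> P \<Longrightarrow> \<theta> \<noteq> \<theta>' \<Longrightarrow> 0 \<le> diff2 I F f \<theta> \<theta>'"
    and gamma: "0 \<le> \<gamma>" "\<And>\<theta>. \<theta> \<in> P \<Longrightarrow> 0 \<le> sink_capacity I F f \<gamma> \<theta>"
begin

abbreviation capD :: "('a, 'b) rotation cut_arc \<Rightarrow> ereal" where
  "capD \<equiv> cut_arc_capacity I F f \<gamma>"

lemma cut_capacity_nonneg: "\<forall>e\<in>arcs cutD. 0 \<le> capD e"
proof
  fix e assume "e \<in> arcs cutD"
  then show "0 \<le> capD e" using diff2_nonneg gamma by (cases e) simp_all
qed

lemma finite_cut_iff:
  "cut_capacity cutD capD ({Source} \<union> Rot ` R) < \<infinity> \<longleftrightarrow>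
    (\<forall>e\<in>arcs cutD. tail cutD e \<in> {Source} \<union> Rot ` R \<longrightarrow> head cutD e \<notin> {Source} \<union> Rot ` R \<longrightarrow> capD e < \<infinity>)"
  by (rule cut_capacity_finite_iff[OF finite_cut_arcs cut_capacity_nonneg])

text \<open>Each kind of infinite arc forces one property of \<open>R\<close>: \<open>Within\<close>
  keeps classes whole, \<open>SourceTrivial\<close> puts \<open>theta_0\<close> inside,
  \<open>TrivialSink\<close> puts \<open>theta_z\<close> outside, and \<open>Precede\<close> gives
  upper closure.\<close>

lemma finite_cut_imp_rotation_set:
  assumes R: "R \<subseteq> rotations I" and fin: "cut_capacity cutD capD ({Source} \<union> Rot ` R) < \<infinity>"
  shows "R \<in> rotation_set I ` F"
proof -
  have cr: "head cutD e \<in> {Source} \<union> Rot ` R"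
    if "e \<in> arcs cutD" "tail cutD e \<in> {Source} \<union> Rot ` R" "capD e = \<infinity>" for e
    using fin that unfolding finite_cut_iff by force
  have cls: "\<theta> \<subseteq> R" if \<theta>: "\<theta> \<in> meta_rotations I F" and \<rho>: "\<rho> \<in> \<theta>" "\<rho> \<in> R" for \<theta> \<rho>
  proof
    fix \<rho>' assume \<rho>': "\<rho>' \<in> \<theta>"
    show "\<rho>' \<in> R"
    proof (cases "\<rho>' = \<rho>")
      case False
      then have "Within \<rho> \<rho>' \<in> arcs cutD" using \<theta> \<rho> \<rho>' by auto
      then show ?thesis using cr[of "Within \<rho> \<rho>'"] \<rho>(2) by (simp add: image_iff)
    qed (use \<rho> in simp)
  qed
  have t0: "theta_0 I F \<subseteq> R"
  proof (cases "theta_0 I F = {}")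
    case False
    have m: "theta_0 I F \<in> meta_rotations I F" by (simp add: meta_rotations_def)
    have "rep (theta_0 I F) \<in> R"
      using cr[of "SourceTrivial (theta_0 I F)"] False by (simp add: image_iff)
    then show ?thesis using cls[OF m rep[OF m False]] by simp
  qed simp
  have tz: "theta_z I F \<inter> R = {}"
  proof (rule ccontr)
    assume ne: "\<not> ?thesis"
    have m: "theta_z I F \<in> meta_rotations I F" by (simp add: meta_rotations_def)
    have "theta_z I F \<subseteq> R" using ne cls[OF m] by blast
    moreover have "rep (theta_z I F) \<in> theta_z I F" using rep[OF m] ne by blast
    ultimately show False
      using cr[of "TrivialSink (theta_z I F)"] ne by auto
  qed
  let ?\<Theta> = "{\<theta> \<in> P. \<theta> \<subseteq> R}"
  have "upset ?\<Theta>"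
    unfolding upper_closed_def
  proof (intro conjI ballI impI)
    fix \<theta> \<theta>' assume \<theta>: "\<theta> \<in> ?\<Theta>" and \<theta>': "\<theta>' \<in> P" "meta_ge I F \<theta>' \<theta>"
    show "\<theta>' \<in> ?\<Theta>"
    proof (cases "\<theta>' = \<theta>")
      case False
      \<comment> \<open>These arcs lead from the smaller to the larger meta-rotation, so a source
        side that none of them leaves is closed upwards.\<close>
      then have "Precede \<theta> \<theta>' \<in> arcs cutD" using \<theta> \<theta>' by (simp add: meta_gt_def)
      moreover have "rep \<theta> \<in> R" using \<theta> rep_proper[of \<theta>] by blast
      ultimately have "rep \<theta>' \<in> R" using cr[of "Precede \<theta> \<theta>'"] by (simp add: image_iff)
      then show ?thesis using cls[of \<theta>' "rep \<theta>'"] rep_proper \<theta>'(1) by (auto simp: meta_rotations_def)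
    qed (use \<theta> in simp)
  qed auto
  then obtain M where M: "M \<in> F" "meta_set I F M = ?\<Theta>" by (auto simp: upset_iff)
  have "R = theta_0 I F \<union> \<Union>?\<Theta>"
  proof (intro subset_antisym subsetI)
    fix \<rho> assume \<rho>: "\<rho> \<in> R"
    then consider "\<rho> \<in> theta_0 I F" | \<theta> where "\<theta> \<in> P" "\<rho> \<in> \<theta>"
      using R tz rotations_partition by blast
    then show "\<rho> \<in> theta_0 I F \<union> \<Union>?\<Theta>"
    proof cases
      case 2
      then have "\<theta> \<subseteq> R" using cls[of \<theta> \<rho>] \<rho> by (simp add: meta_rotations_def)
      then show ?thesis using 2 by blast
    qed simp
  qed (use t0 in auto)
  then have "R = rotation_set I M" using rotation_set_decompose[OF M(1)] M(2) by simp
  then show ?thesis using M(1) by blast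
qed

text \<open>No infinite arc crosses, since classes are all in or all out and the meta-rotations
  inside form an up-set. For finite arcs, the side of an end is the side of the class it
  represents.\<close>

lemma cut_of_matching:
  assumes M: "M \<in> F"
  defines "X \<equiv> {Source} \<union> Rot ` rotation_set I M" and "\<Theta> \<equiv> meta_set I F M"
  shows "{e \<in> arcs cutD. tail cutD e \<in> X \<and> head cutD e \<notin> X} =
    (\<lambda>(\<theta>, \<theta>'). Interact \<theta> \<theta>') ` (\<Theta> \<times> (P - \<Theta>)) \<union> SourceProper ` (P - \<Theta>) \<union> ProperSink ` \<Theta>"
    (is "?L = ?R")
proof -
  have repM: "rep \<theta> \<in> rotation_set I M \<longleftrightarrow> \<theta> \<in> \<Theta>" if "\<theta> \<in> P" for \<theta>
    using proper_mem_iff[OF that rep_proper[OF that] M] that by (simp add: \<Theta>_def meta_set_def)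
  have X: "Source \<in> X" "Sink \<notin> X" "\<And>\<rho>. Rot \<rho> \<in> X \<longleftrightarrow> \<rho> \<in> rotation_set I M"
    by (auto simp: X_def)
  have sub: "\<Theta> \<subseteq> P" unfolding \<Theta>_def by (rule meta_set_subset)
  have t0: "theta_0 I F \<subseteq> rotation_set I M" using M by (auto simp: theta_0_def)
  have tz: "theta_z I F \<inter> rotation_set I M = {}" using M by (auto simp: theta_z_def)
  show ?thesis
  proof (intro subset_antisym subsetI)
    fix e assume "e \<in> ?L"
    then have e: "e \<in> arcs cutD" "tail cutD e \<in> X" "head cutD e \<notin> X" by auto
    show "e \<in> ?R"
    proof (cases e)
      case (Within \<rho> \<rho>')
      then obtain \<theta> where \<theta>: "\<theta> \<in> meta_rotations I F" "\<rho> \<in> \<theta>" "\<rho>' \<in> \<theta>"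
        using e(1) by auto
      have "\<rho> \<in> rotation_set I M" "\<rho>' \<notin> rotation_set I M"
        using e(2,3) Within X by simp_all
      then have False
        using \<theta> t0 tz proper_mem_iff[of \<theta> \<rho> M] M by (auto simp: meta_rotations_def)
      then show ?thesis ..
    next
      case (Precede \<theta> \<theta>')
      then have \<theta>: "\<theta> \<in> P" "\<theta>' \<in> P" "meta_ge I F \<theta>' \<theta>"
        using e(1) by (auto simp: meta_gt_def)
      have "\<theta> \<in> \<Theta>" "\<theta>' \<notin> \<Theta>"
        using e(2,3) Precede X repM \<theta> by simp_all
      then have False using upset_meta_set[OF M] \<theta> by (auto simp: upper_closed_def \<Theta>_def)
      then show ?thesis ..
    next
      case (Interact \<theta> \<theta>')
      then have "\<theta> \<in> P" "\<theta>' \<in> P" using e(1) by auto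
      then show ?thesis using e(2,3) Interact X repM by auto
    next
      case (SourceTrivial \<theta>)
      then have \<theta>: "\<theta> = theta_0 I F" "\<theta> \<noteq> {}" using e(1) by auto
      then have "rep \<theta> \<in> theta_0 I F" using rep[of \<theta>] by (auto simp: meta_rotations_def)
      then have False using e(3) SourceTrivial X t0 by auto
      then show ?thesis ..
    next
      case (TrivialSink \<theta>)
      then have \<theta>: "\<theta> = theta_z I F" "\<theta> \<noteq> {}" using e(1) by auto
      then have "rep \<theta> \<in> theta_z I F" using rep[of \<theta>] by (auto simp: meta_rotations_def)
      then have False using e(2) TrivialSink X tz by auto
      then show ?thesis ..
    next
      case (SourceProper \<theta>)
      then have "\<theta> \<in> P" using e(1) by auto
      then show ?thesis using e(3) SourceProper X repM by auto
    next
      case (ProperSink \<theta>)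
      then have "\<theta> \<in> P" using e(1) by auto
      then show ?thesis using e(2) ProperSink X repM by auto
    qed
  next
    fix e assume "e \<in> ?R"
    then consider \<theta> \<theta>' where "e = Interact \<theta> \<theta>'" "\<theta> \<in> \<Theta>" "\<theta>' \<in> P" "\<theta>' \<notin> \<Theta>"
      | \<theta> where "e = SourceProper \<theta>" "\<theta> \<in> P" "\<theta> \<notin> \<Theta>" | \<theta> where "e = ProperSink \<theta>" "\<theta> \<in> \<Theta>"
      by auto
    then show "e \<in> ?L"
    proof cases
      case 1
      then have "\<theta> \<in> P" "\<theta> \<noteq> \<theta>'" using sub by auto
      then show ?thesis using 1 X repM by simp
    next
      case 2
      then show ?thesis using X repM by simp
    next
      case 3
      then have "\<theta> \<in> P" using sub by auto
      then show ?thesis using 3 X repM by simp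
    qed
  qed
qed

text \<open>A crossing \<open>Interact\<close> arc restores exactly the half interaction that the
  sink arc at its tail deducts, so only deductions for pairs inside \<Theta> survive. Each proper
  meta-rotation pays \<gamma> once: at its source arc when outside, at its sink arc when
  inside.\<close>

lemma cut_capacity_of_matching:
  assumes M: "M \<in> F"
  defines "\<Theta> \<equiv> meta_set I F M"
  shows "cut_capacity cutD capD ({Source} \<union> Rot ` rotation_set I M) =
    ereal ((\<Sum>\<theta>\<in>\<Theta>. diff1 I F f \<theta>)
      - 1/2 * (\<Sum>(\<theta>, \<theta>')\<in>{(\<theta>, \<theta>'). \<theta> \<in> \<Theta> \<and> \<theta>' \<in> \<Theta> \<and> \<theta> \<noteq> \<theta>'}. diff2 I F f \<theta> \<theta>')
      + \<gamma> * card P)"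
proof -
  let ?d = "diff2 I F f"
  have sub: "\<Theta> \<subseteq> P" unfolding \<Theta>_def by (rule meta_set_subset)
  have fin: "finite \<Theta>" "finite (P - \<Theta>)" using finite_subset[OF sub finite_proper] finite_proper by auto
  have "cut_capacity cutD capD ({Source} \<union> Rot ` rotation_set I M) =
    (\<Sum>e\<in>(\<lambda>(\<theta>, \<theta>'). Interact \<theta> \<theta>') ` (\<Theta> \<times> (P - \<Theta>)). capD e)
    + (\<Sum>e\<in>SourceProper ` (P - \<Theta>). capD e) + (\<Sum>e\<in>ProperSink ` \<Theta>. capD e)"
    unfolding cut_capacity_def cut_of_matching[OF M, folded \<Theta>_def]
    by (subst sum.union_disjoint, use fin in \<open>auto\<close>)
      (subst sum.union_disjoint, use fin in \<open>auto\<close>)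
  also have "(\<Sum>e\<in>(\<lambda>(\<theta>, \<theta>'). Interact \<theta> \<theta>') ` (\<Theta> \<times> (P - \<Theta>)). capD e)
    = ereal (\<Sum>\<theta>\<in>\<Theta>. 1/2 * (\<Sum>\<theta>'\<in>P - \<Theta>. ?d \<theta> \<theta>'))"
  proof -
    have "(\<Sum>e\<in>(\<lambda>(\<theta>, \<theta>'). Interact \<theta> \<theta>') ` (\<Theta> \<times> (P - \<Theta>)). capD e)
      = (\<Sum>(\<theta>, \<theta>')\<in>\<Theta> \<times> (P - \<Theta>). ereal (1/2 * ?d \<theta> \<theta>'))"
      by (subst sum.reindex) (auto simp: inj_on_def intro!: sum.cong)
    also have "\<dots> = (\<Sum>\<theta>\<in>\<Theta>. \<Sum>\<theta>'\<in>P - \<Theta>. ereal (1/2 * ?d \<theta> \<theta>'))"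
      by (rule sum.cartesian_product[symmetric])
    finally show ?thesis by (simp add: sum_distrib_left)
  qed
  also have "(\<Sum>e\<in>SourceProper ` (P - \<Theta>). capD e) = ereal (\<Sum>\<theta>\<in>P - \<Theta>. \<gamma>)"
    by (subst sum.reindex, simp add: inj_on_def, simp only: o_def cut_arc_capacity.simps sum_ereal)
  also have "(\<Sum>e\<in>ProperSink ` \<Theta>. capD e) = ereal (\<Sum>\<theta>\<in>\<Theta>. sink_capacity I F f \<gamma> \<theta>)"
    by (subst sum.reindex, simp add: inj_on_def, simp only: o_def cut_arc_capacity.simps sum_ereal)
  also have "(\<Sum>\<theta>\<in>\<Theta>. sink_capacity I F f \<gamma> \<theta>) = (\<Sum>\<theta>\<in>\<Theta>. diff1 I F f \<theta>)
    - (\<Sum>\<theta>\<in>\<Theta>. 1/2 * (\<Sum>\<theta>'\<in>P - \<Theta>. ?d \<theta> \<theta>')) - 1/2 * (\<Sum>\<theta>\<in>\<Theta>. \<Sum>\<theta>'\<in>\<Theta> - {\<theta>}. ?d \<theta> \<theta>')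
    + (\<Sum>\<theta>\<in>\<Theta>. \<gamma>)"
  proof -
    have "(\<Sum>\<theta>'\<in>P - {\<theta>}. ?d \<theta> \<theta>') = (\<Sum>\<theta>'\<in>P - \<Theta>. ?d \<theta> \<theta>') + (\<Sum>\<theta>'\<in>\<Theta> - {\<theta>}. ?d \<theta> \<theta>')"
      if "\<theta> \<in> \<Theta>" for \<theta>
    proof -
      have eq: "P - {\<theta>} = (P - \<Theta>) \<union> (\<Theta> - {\<theta>})" using sub that by auto
      show ?thesis unfolding eq by (rule sum.union_disjoint) (use fin in auto)
    qed
    then have "(\<Sum>\<theta>\<in>\<Theta>. sink_capacity I F f \<gamma> \<theta>) = (\<Sum>\<theta>\<in>\<Theta>. diff1 I F f \<theta>
      - 1/2 * (\<Sum>\<theta>'\<in>P - \<Theta>. ?d \<theta> \<theta>') - 1/2 * (\<Sum>\<theta>'\<in>\<Theta> - {\<theta>}. ?d \<theta> \<theta>') + \<gamma>)"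
      by (intro sum.cong refl) (simp add: sink_capacity_def field_simps)
    then show ?thesis by (simp add: sum.distrib sum_subtractf sum_distrib_left)
  qed
  also have "(\<Sum>\<theta>\<in>\<Theta>. \<Sum>\<theta>'\<in>\<Theta> - {\<theta>}. ?d \<theta> \<theta>')
    = (\<Sum>(\<theta>, \<theta>')\<in>{(\<theta>, \<theta>'). \<theta> \<in> \<Theta> \<and> \<theta>' \<in> \<Theta> \<and> \<theta> \<noteq> \<theta>'}. ?d \<theta> \<theta>')"
    using fin by (subst sum.Sigma) (auto intro!: sum.cong)
  finally have "cut_capacity cutD capD ({Source} \<union> Rot ` rotation_set I M) =
    ereal ((\<Sum>\<theta>\<in>\<Theta>. diff1 I F f \<theta>)
      - 1/2 * (\<Sum>(\<theta>, \<theta>')\<in>{(\<theta>, \<theta>'). \<theta> \<in> \<Theta> \<and> \<theta>' \<in> \<Theta> \<and> \<theta> \<noteq> \<theta>'}. ?d \<theta> \<theta>')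
      + ((\<Sum>\<theta>\<in>P - \<Theta>. \<gamma>) + (\<Sum>\<theta>\<in>\<Theta>. \<gamma>)))"
    by simp
  also have "(\<Sum>\<theta>\<in>P - \<Theta>. \<gamma>) + (\<Sum>\<theta>\<in>\<Theta>. \<gamma>) = (\<Sum>\<theta>\<in>P. \<gamma>)"
    by (rule sum.subset_diff[OF sub finite_proper, symmetric])
  finally show ?thesis by (simp add: mult.commute)
qed

lemma cut_digraph_witness:
  assumes f: "\<And>M. M \<in> F \<Longrightarrow> f M = f (M_0F I F) + (\<Sum>\<theta>\<in>meta_set I F M. diff1 I F f \<theta>)
      - 1/2 * (\<Sum>(\<theta>, \<theta>')\<in>{(\<theta>, \<theta>'). \<theta> \<in> meta_set I F M \<and> \<theta>' \<in> meta_set I F M \<and> \<theta> \<noteq> \<theta>'}.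
                 diff2 I F f \<theta> \<theta>')"
  shows "witness_digraph I F f cutD capD"
proof -
  let ?c = "\<lambda>R. cut_capacity cutD capD ({Source} \<union> Rot ` R)"
  \<comment> \<open>The expansion starts from \<open>f (M_0F I F)\<close>, which no arc carries,
    while every finite cut pays \<gamma> for each proper meta-rotation.\<close>
  let ?C = "\<gamma> * card P - f (M_0F I F)"
  have val: "?c (rotation_set I M) = ereal (f M + ?C)" if M: "M \<in> F" for M
    using cut_capacity_of_matching[OF M] f[OF M] by simp
  have ne: "S \<noteq> {}" using nonempty F_stable by blast
  have iff: "upper_closed (rotations I) (rotation_ge I) R \<and> matching_of I R \<in> F \<longleftrightarrow> R \<in> rotation_set I ` F" for R
    unfolding upper_closed_iff[OF ne] using matching_of_rotation_set F_stable by force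
  have fin: "?c R < \<infinity> \<longleftrightarrow> R \<in> rotation_set I ` F" if "R \<subseteq> rotations I" for R
    using finite_cut_imp_rotation_set[OF that] val by auto
  have "?c R = ereal (f (matching_of I R) + ?C)" if "R \<subseteq> rotations I" "?c R < \<infinity>" for R
    using that fin[OF that(1)] val matching_of_rotation_set F_stable by auto
  then show ?thesis
    unfolding witness_digraph_def iff
    using fin_digraph_cut cut_capacity_nonneg fin
    by (intro conjI exI[of _ ?C]) auto
qed

end

end

lemma exists_sink_constant:
  obtains \<gamma> where "0 \<le> \<gamma>" "\<And>\<theta>. \<theta> \<in> P \<Longrightarrow> 0 \<le> sink_capacity I F f \<gamma> \<theta>"
proof
  \<comment> \<open>\<open>sink_capacity\<close> has slope 1 in \<gamma>, and the sum of the
    absolute values at 0 bounds each of them.\<close>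
  let ?\<gamma> = "\<Sum>\<theta>\<in>P. \<bar>sink_capacity I F f 0 \<theta>\<bar>"
  show "0 \<le> ?\<gamma>" by (simp add: sum_nonneg)
  fix \<theta> assume "\<theta> \<in> P"
  then have "\<bar>sink_capacity I F f 0 \<theta>\<bar> \<le> ?\<gamma>" using finite_proper by (intro member_le_sum) auto
  then show "0 \<le> sink_capacity I F f ?\<gamma> \<theta>" by (simp add: sink_capacity_def)
qed

end

theorem theorem3:
  fixes I :: "('a, 'b) school_instance"
    and F :: "('a, 'b) matching set"
    and f :: "('a, 'b) matching \<Rightarrow> real"
  assumes "school_matching_instance I"
    and "F \<subseteq> stable_matchings I"
    and "F \<noteq> {}"
  shows "(min_cut_representable I F f \<longleftrightarrow>
            is_sublattice I F \<and>
            (\<forall>\<theta>\<in>proper_meta_rotations I F. \<forall>\<theta>'\<in>proper_meta_rotations I F.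
               \<theta> \<noteq> \<theta>' \<longrightarrow> 0 \<le> diff2 I F f \<theta> \<theta>') \<and>
            (\<forall>M\<in>F. f M = f (M_0F I F) + (\<Sum>\<theta>\<in>meta_set I F M. diff1 I F f \<theta>)
               - 1/2 * (\<Sum>(\<theta>, \<theta>')\<in>{(\<theta>, \<theta>'). \<theta> \<in> meta_set I F M \<and> \<theta>' \<in> meta_set I F M \<and> \<theta> \<noteq> \<theta>'}.
                          diff2 I F f \<theta> \<theta>')))
       \<and> (min_cut_representable I F f \<longrightarrow>
            (\<forall>rep \<gamma>.
               (\<forall>\<theta>\<in>meta_rotations I F. \<theta> \<noteq> {} \<longrightarrow> rep \<theta> \<in> \<theta>) \<longrightarrow>
               0 \<le> \<gamma> \<longrightarrow>
               (\<forall>\<theta>\<in>proper_meta_rotations I F. 0 \<le> sink_capacity I F f \<gamma> \<theta>) \<longrightarrow>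
               witness_digraph I F f (cut_digraph I F rep) (cut_arc_capacity I F f \<gamma>)))"
    (is "(?mc \<longleftrightarrow> ?i \<and> ?ii \<and> ?iii) \<and> (?mc \<longrightarrow> ?wit)")
proof -
  interpret school_market I by unfold_locales (rule assms(1))
  have nec: "?i \<and> ?ii \<and> ?iii" if mc: ?mc
  proof -
    obtain D :: "(('a, 'b) rotation vertex, nat) pre_digraph" and cap where w: "witness_digraph I F f D cap"
      using mc unfolding min_cut_representable_def by blast
    have i: ?i by (rule witness_imp_sublattice[OF w assms(2)])
    \<comment> \<open>The correspondence with up-sets, on which the differentials rest, becomes
      available with condition (i).\<close>
    interpret stable_sublattice I F by unfold_locales (rule i assms(3))+
    show ?thesis using i witness_imp_differentials[OF w] by blast
  qed
  have suf: ?wit if c: "?i \<and> ?ii \<and> ?iii"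
  proof (intro allI impI)
    fix rep \<gamma> assume h: "\<forall>\<theta>\<in>meta_rotations I F. \<theta> \<noteq> {} \<longrightarrow> rep \<theta> \<in> \<theta>" "0 \<le> \<gamma>"
      "\<forall>\<theta>\<in>proper_meta_rotations I F. 0 \<le> sink_capacity I F f \<gamma> \<theta>"
    interpret stable_sublattice I F by unfold_locales (use c assms(3) in auto)
    show "witness_digraph I F f (cut_digraph I F rep) (cut_arc_capacity I F f \<gamma>)"
    proof (rule cut_digraph_witness)
      show "rep \<theta> \<in> \<theta>" if "\<theta> \<in> meta_rotations I F" "\<theta> \<noteq> {}" for \<theta> using h(1) that by blast
      show "0 \<le> diff2 I F f \<theta> \<theta>'" if "\<theta> \<in> P" "\<theta>' \<in> P" "\<theta> \<noteq> \<theta>'" for \<theta> \<theta>'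
        using c that by blast
      show "0 \<le> \<gamma>" by (rule h(2))
      show "0 \<le> sink_capacity I F f \<gamma> \<theta>" if "\<theta> \<in> P" for \<theta> using h(3) that by blast
      show "f M = f (M_0F I F) + (\<Sum>\<theta>\<in>meta_set I F M. diff1 I F f \<theta>)
          - 1/2 * (\<Sum>(\<theta>, \<theta>')\<in>{(\<theta>, \<theta>'). \<theta> \<in> meta_set I F M \<and> \<theta>' \<in> meta_set I F M \<and> \<theta> \<noteq> \<theta>'}.
                     diff2 I F f \<theta> \<theta>')" if "M \<in> F" for M
        by (rule c[THEN conjunct2, THEN conjunct2, rule_format, OF that])
    qed
  qed
  have "?mc" if c: "?i \<and> ?ii \<and> ?iii"
  proof -
    interpret stable_sublattice I F by unfold_locales (use c assms(3) in auto)
    obtain \<gamma> where \<gamma>: "0 \<le> \<gamma>" "\<And>\<theta>. \<theta> \<in> P \<Longrightarrow> 0 \<le> sink_capacity I F f \<gamma> \<theta>"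
      using exists_sink_constant by blast
    \<comment> \<open>Any representatives and any admissible \<gamma> give a witness; its arcs are
      then renamed to naturals.\<close>
    let ?rep = "\<lambda>\<theta>. SOME \<rho>. \<rho> \<in> \<theta>"
    have "witness_digraph I F f (cut_digraph I F ?rep) (cut_arc_capacity I F f \<gamma>)"
      by (rule suf[OF c, rule_format]) (simp_all add: some_in_eq \<gamma>)
    then show ?thesis by (rule witness_rename)
  qed
  then show ?thesis using nec suf by blast
qed

end
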